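(* Let $\{\zeta_t,t\in\mathbb Z\}$ be i.i.d. with $E\zeta_0=0$, $E\zeta_0^2=1$, $E|\zeta_0|^3<\infty$ and $\mu_3=E\zeta_0^3=0$. Let $a\in\mathbb R$, $c\ge0$ and real $b_j$, $j\ge1$, with $B^2:=\sum_{j\ge1}b_j^2<1/5$. Let $\{r_t\}$ be a stationary $L^2$-solution of $$r_t=\zeta_t\sigma_t,\qquad \sigma_t=\sqrt{c^2+\Big(a+\sum_{s<t}b_{t-s}r_s\Big)^2},\quad t\in\mathbb Z,$$ with $E|r_0|^3<\infty$, and let $h_j:=\mathrm{Cov}(\sigma_t^2,r_{t-j})$, $j\ge1$. Then for any fixed $k$ with $1\le k\le\infty$: (i) if $ab_1<0$ and $ab_j\le0$ for $j=2,\dots,k$, then $h_j<0$ for all $1\le j\le k$; (ii) if $ab_1>0$ and $ab_j\ge0$ for $j=2,\dots,k$, then $h_j>0$ for all $1\le j\le k$. (For $k=\infty$, $j$ ranges over all positive integers.)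
   Context: $\mathcal F_t:=\sigma(\zeta_s,s\le t)$; a process is adapted if $r_t$ is $\mathcal F_t$-measurable for each $t$. An $L^2$-solution of the displayed equation is an adapted process $\{r_t\}$ with $Er_t^2<\infty$ such that for every $t$ the series $\sum_{s<t}b_{t-s}r_s$ converges in $L^2$ and the equation holds. By stationarity $h_j$ does not depend on $t$. *)

theory Defs
  imports "HOL-Probability.Probability"
begin

definition nat_filtration :: "'a measure \<Rightarrow> (int \<Rightarrow> 'a \<Rightarrow> real) \<Rightarrow> int \<Rightarrow> 'a measure" where
  "nat_filtration M \<zeta> t =
     sigma (space M) (\<Union>s\<in>{..t}. {\<zeta> s -` A \<inter> space M | A. A \<in> sets borel})"

definition cov :: "'a measure \<Rightarrow> ('a \<Rightarrow> real) \<Rightarrow> ('a \<Rightarrow> real) \<Rightarrow> real" where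
  "cov M X Y = (\<integral>\<omega>. (X \<omega> - (\<integral>x. X x \<partial>M)) * (Y \<omega> - (\<integral>x. Y x \<partial>M)) \<partial>M)"

definition strictly_stationary :: "'a measure \<Rightarrow> (int \<Rightarrow> 'a \<Rightarrow> real) \<Rightarrow> bool" where
  "strictly_stationary M X \<longleftrightarrow>
     (\<forall>I h. finite I \<longrightarrow>
        distr M (PiM I (\<lambda>_. borel)) (\<lambda>\<omega>. \<lambda>i\<in>I. X (i + h) \<omega>) =
        distr M (PiM I (\<lambda>_. borel)) (\<lambda>\<omega>. \<lambda>i\<in>I. X i \<omega>))"

definition L2_limit :: "'a measure \<Rightarrow> (nat \<Rightarrow> 'a \<Rightarrow> real) \<Rightarrow> ('a \<Rightarrow> real) \<Rightarrow> bool" where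
  "L2_limit M S Y \<longleftrightarrow>
     Y \<in> borel_measurable M \<and> integrable M (\<lambda>\<omega>. (Y \<omega>)\<^sup>2) \<and>
     (\<lambda>n. \<integral>\<omega>. (S n \<omega> - Y \<omega>)\<^sup>2 \<partial>M) \<longlonglongrightarrow> 0"

end

theory Submission
  imports Defs
begin

text \<open>
  Put \<open>m = E r\<^sub>0\<^sup>2\<close> and split \<open>X\<^sub>0 = (\<Sum>u<j. b\<^sub>u r\<^sub>-\<^sub>u) + b\<^sub>j r\<^sub>-\<^sub>j + Y\<^sub>j\<close>, where \<open>Y\<^sub>j\<close> is measurable with
  respect to the past before time \<open>-j\<close>. Since \<open>r\<close> is a martingale difference sequence and
  \<open>\<mu>\<^sub>3 = 0\<close>, expanding the square gives
  \<open>h\<^sub>j = 2 a m b\<^sub>j + (\<Sum>u<j. b\<^sub>u\<^sup>2 h\<^sub>j\<^sub>-\<^sub>u) + 2 b\<^sub>j S\<^sub>j\<close> with \<open>S\<^sub>j = E (r\<^sub>-\<^sub>j\<^sup>2 Y\<^sub>j) = (\<Sum>i\<ge>1. b\<^sub>j\<^sub>+\<^sub>i h\<^sub>i)\<close>.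
  Third moments bound \<open>S\<^sub>j\<close> uniformly in \<open>j\<close>, so the recursion and Young's inequality show that
  \<open>h\<close> is square summable. Inserting \<open>\<bar>S\<^sub>j\<bar> \<le> B \<parallel>h\<parallel>\<close> back into the recursion yields
  \<open>(1 - 3 B\<^sup>2) \<parallel>h\<parallel> \<le> 2 \<bar>a\<bar> m B\<close>, hence \<open>\<bar>S\<^sub>j\<bar> < \<bar>a\<bar> m\<close> because \<open>5 B\<^sup>2 < 1\<close>. Therefore
  \<open>2 b\<^sub>j (a m + S\<^sub>j)\<close> has the sign of \<open>a b\<^sub>j\<close>, and the sign of \<open>h\<^sub>j\<close> follows by induction on \<open>j\<close>.
\<close>

section \<open>Truncated Young inequality and the deterministic analysis of the recursion\<close>

lemma L2_set_sum_le:
  "finite U \<Longrightarrow> L2_set (\<lambda>j. \<Sum>u\<in>U. f u j) A \<le> (\<Sum>u\<in>U. L2_set (f u) A)"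
proof (induction U rule: finite_induct)
  case empty
  then show ?case by (simp add: L2_set_0')
next
  case (insert v U)
  have "L2_set (\<lambda>j. \<Sum>u\<in>insert v U. f u j) A = L2_set (\<lambda>j. f v j + (\<Sum>u\<in>U. f u j)) A"
    using insert by simp
  also have "\<dots> \<le> L2_set (f v) A + L2_set (\<lambda>j. \<Sum>u\<in>U. f u j) A"
    by (rule L2_set_triangle_ineq)
  finally show ?case using insert by simp
qed

lemma L2_set_shift_le:
  fixes g :: "nat \<Rightarrow> real"
  shows "L2_set (\<lambda>j. if u < j then g (j - u) else 0) {1..N} \<le> L2_set g {1..N}"
proof -
  have "(\<Sum>j=1..N. (if u < j then g (j - u) else 0)\<^sup>2) = (\<Sum>j\<in>{u<..N}. (g (j - u))\<^sup>2)"
    by (rule sum.mono_neutral_cong_right) auto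
  also have "\<dots> \<le> (\<Sum>j=1..N. (g j)\<^sup>2)"
    by (rule sum_le_included[where i = "\<lambda>j. j + u"]) (auto intro!: bexI)
  finally show ?thesis
    by (simp add: L2_set_def)
qed

text \<open>Young's inequality for a convolution of an l1 with an l2 sequence: the convolution is a
  weighted sum of shifts, and shifting does not increase the norm. Truncation at \<open>N\<close>
  makes it usable before \<open>g\<close> is known to be square summable.\<close>

lemma L2_set_convolution_le:
  fixes w g :: "nat \<Rightarrow> real"
  assumes w: "\<And>u. w u \<ge> 0"
  shows "L2_set (\<lambda>j. \<Sum>u\<in>{1..<j}. w u * g (j - u)) {1..N} \<le> (\<Sum>u=1..N. w u) * L2_set g {1..N}"
proof -
  \<comment> \<open>Padding with 0 for \<open>u \<ge> j\<close> makes the summation range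
    independent of \<open>j\<close>, as Minkowski's inequality requires.\<close>
  have "L2_set (\<lambda>j. \<Sum>u\<in>{1..<j}. w u * g (j - u)) {1..N}
      = L2_set (\<lambda>j. \<Sum>u=1..N. w u * (if u < j then g (j - u) else 0)) {1..N}"
    by (intro L2_set_cong refl sum.mono_neutral_cong_left) auto
  also have "\<dots> \<le> (\<Sum>u=1..N. L2_set (\<lambda>j. w u * (if u < j then g (j - u) else 0)) {1..N})"
    by (rule L2_set_sum_le) simp
  also have "\<dots> = (\<Sum>u=1..N. w u * L2_set (\<lambda>j. if u < j then g (j - u) else 0) {1..N})"
    by (simp only: L2_set_right_distrib[OF w])
  also have "\<dots> \<le> (\<Sum>u=1..N. w u * L2_set g {1..N})"
    by (intro sum_mono mult_left_mono L2_set_shift_le w)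
  also have "\<dots> = (\<Sum>u=1..N. w u) * L2_set g {1..N}"
    by (simp add: sum_distrib_right)
  finally show ?thesis .
qed

text \<open>Applied twice: with the a priori bound on the remainder it yields square summability of
  the leverage coefficients, after which the remainder itself is controlled by their norm.\<close>
lemma leverage_L2_set_bound:
  fixes b h :: "nat \<Rightarrow> real"
  assumes b2: "\<And>N. (\<Sum>j=1..N. (b j)\<^sup>2) \<le> B2"
    and bound: "\<And>j. 1 \<le> j \<Longrightarrow> \<bar>h j\<bar> \<le> C * \<bar>b j\<bar> + (\<Sum>u\<in>{1..<j}. (b u)\<^sup>2 * \<bar>h (j - u)\<bar>)"
    and C: "C \<ge> 0"
  shows "(1 - B2) * L2_set h {1..N} \<le> C * sqrt B2"
proof -
  have [simp]: "L2_set (\<lambda>j. \<bar>h j\<bar>) A = L2_set h A" for A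
    by (simp add: L2_set_def)
  have bL2: "L2_set b {1..N} \<le> sqrt B2"
    using b2 by (simp add: L2_set_def)
  have "L2_set h {1..N} = L2_set (\<lambda>j. \<bar>h j\<bar>) {1..N}" by simp
  also have "\<dots> \<le> L2_set (\<lambda>j. C * \<bar>b j\<bar> + (\<Sum>u\<in>{1..<j}. (b u)\<^sup>2 * \<bar>h (j - u)\<bar>)) {1..N}"
    using bound by (intro L2_set_mono) auto
  also have "\<dots> \<le> L2_set (\<lambda>j. C * \<bar>b j\<bar>) {1..N}
      + L2_set (\<lambda>j. \<Sum>u\<in>{1..<j}. (b u)\<^sup>2 * \<bar>h (j - u)\<bar>) {1..N}"
    by (rule L2_set_triangle_ineq)
  also have "\<dots> \<le> C * L2_set b {1..N} + (\<Sum>u=1..N. (b u)\<^sup>2) * L2_set h {1..N}"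
  proof (rule add_mono)
    show "L2_set (\<lambda>j. C * \<bar>b j\<bar>) {1..N} \<le> C * L2_set b {1..N}"
      by (subst L2_set_right_distrib[OF C]) (simp add: L2_set_def power_mult_distrib)
    show "L2_set (\<lambda>j. \<Sum>u\<in>{1..<j}. (b u)\<^sup>2 * \<bar>h (j - u)\<bar>) {1..N}
        \<le> (\<Sum>u=1..N. (b u)\<^sup>2) * L2_set h {1..N}"
      using L2_set_convolution_le[of "\<lambda>u. (b u)\<^sup>2" "\<lambda>j. \<bar>h j\<bar>" N] by simp
  qed
  also have "\<dots> \<le> C * sqrt B2 + B2 * L2_set h {1..N}"
    using bL2 b2 C by (intro add_mono mult_left_mono mult_right_mono) auto
  finally show ?thesis by (simp add: algebra_simps)
qed

text \<open>A bootstrap in two passes. The first uses the crude bound \<open>K\<close> only to see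
  that \<open>h\<close> is square summable; the second replaces \<open>K\<close> by
  \<open>sqrt B2\<close> times the norm of \<open>h\<close>, which yields a bound free of
  \<open>K\<close>.\<close>

lemma leverage_remainder_bound:
  fixes b h S :: "nat \<Rightarrow> real"
  assumes b2: "\<And>N. (\<Sum>j=1..N. (b j)\<^sup>2) \<le> B2"
    and B2: "B2 < 1/5"
    and rec: "\<And>j. 1 \<le> j \<Longrightarrow> h j = 2 * A * b j + (\<Sum>u\<in>{1..<j}. (b u)\<^sup>2 * h (j - u)) + 2 * b j * S j"
    and K: "\<And>j. 1 \<le> j \<Longrightarrow> \<bar>S j\<bar> \<le> K"
    and lim: "\<And>j. 1 \<le> j \<Longrightarrow> (\<lambda>N. \<Sum>i=1..N. b (j + i) * h i) \<longlonglongrightarrow> S j"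
    and A: "A \<noteq> 0"
    and j: "1 \<le> j"
  shows "\<bar>S j\<bar> < \<bar>A\<bar>"
proof -
  have B20: "B2 \<ge> 0" using b2[of 0] by simp
  have step: "(1 - B2) * L2_set h {1..N} \<le> (2 * \<bar>A\<bar> + 2 * K') * sqrt B2"
    if K': "\<And>j. 1 \<le> j \<Longrightarrow> \<bar>S j\<bar> \<le> K'" for K' N
  proof (rule leverage_L2_set_bound[OF b2])
    have "0 \<le> K'" using K'[of 1] by simp
    then show "0 \<le> 2 * \<bar>A\<bar> + 2 * K'" by simp
    fix j :: nat assume j: "1 \<le> j"
    have "\<bar>h j\<bar> \<le> \<bar>2 * A * b j\<bar> + \<bar>\<Sum>u\<in>{1..<j}. (b u)\<^sup>2 * h (j - u)\<bar> + \<bar>2 * b j * S j\<bar>"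
      unfolding rec[OF j] by linarith
    also have "\<bar>\<Sum>u\<in>{1..<j}. (b u)\<^sup>2 * h (j - u)\<bar> \<le> (\<Sum>u\<in>{1..<j}. (b u)\<^sup>2 * \<bar>h (j - u)\<bar>)"
      by (rule order_trans[OF sum_abs]) (simp add: abs_mult)
    also have "\<bar>2 * b j * S j\<bar> \<le> 2 * K' * \<bar>b j\<bar>"
      using mult_left_mono[OF K'[OF j], of "2 * \<bar>b j\<bar>"] by (simp add: abs_mult mult_ac)
    finally show "\<bar>h j\<bar> \<le> (2 * \<bar>A\<bar> + 2 * K') * \<bar>b j\<bar> + (\<Sum>u\<in>{1..<j}. (b u)\<^sup>2 * \<bar>h (j - u)\<bar>)"
      by (simp add: abs_mult algebra_simps)
  qed
  \<comment> \<open>\<open>L\<close> is the l2 norm of \<open>h\<close>; it is meaningful only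
    because the pass with \<open>K\<close> bounds the truncated norms uniformly.\<close>
  define L where "L = (SUP N. L2_set h {1..N})"
  have bdd: "bdd_above (range (\<lambda>N. L2_set h {1..N}))"
  proof (rule bdd_aboveI2)
    fix N
    show "L2_set h {1..N} \<le> (2 * \<bar>A\<bar> + 2 * K) * sqrt B2 / (1 - B2)"
      using step[OF K, of N] B2 by (simp add: field_simps)
  qed
  have hL: "L2_set h {1..N} \<le> L" for N
    unfolding L_def by (rule cSUP_upper[OF _ bdd]) simp
  have L0: "0 \<le> L" using hL[of 0] by simp
  \<comment> \<open>Cauchy-Schwarz for the partial sums, with a tail of \<open>b\<close> against
    \<open>h\<close>, followed by the limit.\<close>
  have SL: "\<bar>S j\<bar> \<le> sqrt B2 * L" if j: "1 \<le> j" for j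
  proof (rule Lim_bounded)
    show "(\<lambda>N. \<bar>\<Sum>i=1..N. b (j + i) * h i\<bar>) \<longlonglongrightarrow> \<bar>S j\<bar>"
      by (intro tendsto_rabs lim j)
    show "\<forall>N\<ge>0. \<bar>\<Sum>i=1..N. b (j + i) * h i\<bar> \<le> sqrt B2 * L"
    proof (intro allI impI)
      fix N :: nat
      have "(\<Sum>i=1..N. (b (j + i))\<^sup>2) \<le> (\<Sum>i=1..j+N. (b i)\<^sup>2)"
        by (rule sum_le_included[where i = "\<lambda>i. i - j"]) (auto intro!: bexI[where x = "j + _"])
      also note b2
      finally have bL2: "L2_set (\<lambda>i. b (j + i)) {1..N} \<le> sqrt B2"
        by (simp add: L2_set_def)
      have "\<bar>\<Sum>i=1..N. b (j + i) * h i\<bar> \<le> (\<Sum>i=1..N. \<bar>b (j + i)\<bar> * \<bar>h i\<bar>)"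
        by (rule order_trans[OF sum_abs]) (simp add: abs_mult)
      also have "\<dots> \<le> L2_set (\<lambda>i. b (j + i)) {1..N} * L2_set h {1..N}"
        by (rule L2_set_mult_ineq)
      also have "\<dots> \<le> sqrt B2 * L"
        using bL2 hL B20 by (intro mult_mono) auto
      finally show "\<bar>\<Sum>i=1..N. b (j + i) * h i\<bar> \<le> sqrt B2 * L" .
    qed
  qed
  have "L \<le> (2 * \<bar>A\<bar> + 2 * (sqrt B2 * L)) * sqrt B2 / (1 - B2)"
    unfolding L_def[symmetric]
  proof (subst L_def, rule cSUP_least)
    fix N
    show "L2_set h {1..N} \<le> (2 * \<bar>A\<bar> + 2 * (sqrt B2 * L)) * sqrt B2 / (1 - B2)"
      using step[OF SL, of N] B2 by (simp add: field_simps)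
  qed simp
  then have "(1 - B2) * L \<le> (2 * \<bar>A\<bar> + 2 * (sqrt B2 * L)) * sqrt B2"
    using B2 by (simp add: field_simps)
  also have "\<dots> = 2 * \<bar>A\<bar> * sqrt B2 + 2 * L * (sqrt B2 * sqrt B2)"
    by (simp add: algebra_simps)
  finally have "(1 - 3 * B2) * L \<le> 2 * \<bar>A\<bar> * sqrt B2"
    using B20 by (simp add: algebra_simps)
  from mult_left_mono[OF this, of "sqrt B2"] B20
  have "(1 - 3 * B2) * (sqrt B2 * L) \<le> 2 * \<bar>A\<bar> * (sqrt B2 * sqrt B2)"
    by (simp only: mult_ac real_sqrt_ge_zero)
  then have "(1 - 3 * B2) * (sqrt B2 * L) \<le> \<bar>A\<bar> * (2 * B2)"
    using B20 by simp
  \<comment> \<open>Here the constant 1/5 enters: \<open>2 * B2 < 1 - 3 * B2\<close> is the same as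
    \<open>B2 < 1/5\<close>.\<close>
  also have "\<dots> < \<bar>A\<bar> * (1 - 3 * B2)"
    using A B2 by (intro mult_strict_left_mono) auto
  finally have "sqrt B2 * L < \<bar>A\<bar>"
    using B2 by (simp add: mult.commute)
  with SL[OF j] show ?thesis by simp
qed

text \<open>The first and last terms combine to \<open>2 * A * b j * (1 + S j / A)\<close>, whose
  last factor is positive since \<open>S j\<close> is smaller than \<open>A\<close> in absolute
  value. For \<open>j \<ge> 2\<close> this contribution may vanish; strictness then comes from the
  summand \<open>u = 1\<close>, where \<open>b 1\<close> is nonzero and \<open>h (j - 1)\<close> is
  positive by induction.\<close>

lemma leverage_pos:
  fixes b h S :: "nat \<Rightarrow> real"
  assumes rec: "\<And>j. 1 \<le> j \<Longrightarrow> h j = 2 * A * b j + (\<Sum>u\<in>{1..<j}. (b u)\<^sup>2 * h (j - u)) + 2 * b j * S j"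
    and S: "\<And>j. 1 \<le> j \<Longrightarrow> \<bar>S j\<bar> < \<bar>A\<bar>"
    and b1: "A * b 1 > 0"
    and bj: "\<And>j. 2 \<le> j \<Longrightarrow> enat j \<le> k \<Longrightarrow> A * b j \<ge> 0"
  shows "1 \<le> j \<Longrightarrow> enat j \<le> k \<Longrightarrow> h j > 0"
proof (induction j rule: less_induct)
  case (less j)
  have factor: "2 * A * b i + 2 * b i * S i = 2 * (A * b i) * (1 + S i / A)" for i
    using b1 by (auto simp: field_simps)
  have pos: "0 < 1 + S i / A" if "1 \<le> i" for i
  proof -
    have "\<bar>S i / A\<bar> < 1" using S[OF that] b1 by (auto simp: field_simps)
    then show ?thesis by linarith
  qed
  show ?case
  proof (cases "j = 1")
    case True
    then show ?thesis
      using rec[of 1] factor[of 1] pos[of 1] b1 by simp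
  next
    case False
    with less.prems have j2: "2 \<le> j" by simp
    have IH: "0 < h i" if "1 \<le> i" "i < j" for i
      using less.IH[of i] that less.prems by (meson enat_ord_simps(1) less_imp_le order_trans)
    have "0 < (\<Sum>u\<in>{1..<j}. (b u)\<^sup>2 * h (j - u))"
    proof (rule sum_pos2[where i = 1])
      show "0 < (b 1)\<^sup>2 * h (j - 1)"
        using IH[of "j - 1"] b1 j2 by (intro mult_pos_pos) auto
      show "0 \<le> (b u)\<^sup>2 * h (j - u)" if "u \<in> {1..<j}" for u
        using that by (intro mult_nonneg_nonneg less_imp_le[OF IH]) auto
    qed (use j2 in auto)
    moreover have "0 \<le> 2 * (A * b j) * (1 + S j / A)"
      using bj[OF j2 less.prems(2)] pos[of j] j2 by auto
    ultimately show ?thesis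
      using rec[OF less.prems(1)] factor[of j] by simp
  qed
qed

section \<open>Functions with a finite third absolute moment\<close>

definition L3 :: "'a measure \<Rightarrow> ('a \<Rightarrow> real) \<Rightarrow> bool" where
  "L3 M f \<longleftrightarrow> f \<in> borel_measurable M \<and> integrable M (\<lambda>\<omega>. \<bar>f \<omega>\<bar> ^ 3)"

lemma L3_measurable: "L3 M f \<Longrightarrow> f \<in> borel_measurable M"
  by (simp add: L3_def)

lemma abs_cube_add_le: "\<bar>x + y\<bar> ^ 3 \<le> 8 * (\<bar>x\<bar> ^ 3 + \<bar>y\<bar> ^ 3)" for x y :: real
proof -
  define z where "z = max \<bar>x\<bar> \<bar>y\<bar>"
  have "\<bar>x + y\<bar> ^ 3 \<le> (2 * z) ^ 3"
    unfolding z_def by (intro power_mono) auto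
  also have "\<dots> = 8 * z ^ 3" by (simp add: power_mult_distrib)
  also have "z ^ 3 \<le> \<bar>x\<bar> ^ 3 + \<bar>y\<bar> ^ 3"
    unfolding z_def by (auto simp: max_def)
  finally show ?thesis by simp
qed

text \<open>Crude domination by the largest factor. It makes every product of three
  \<open>L3\<close> functions integrable, which covers all the third-order moments below.\<close>

lemma abs_mult3_le: "\<bar>x * y * z\<bar> \<le> \<bar>x\<bar> ^ 3 + \<bar>y\<bar> ^ 3 + \<bar>z\<bar> ^ 3" for x y z :: real
proof -
  define m where "m = max \<bar>x\<bar> (max \<bar>y\<bar> \<bar>z\<bar>)"
  have "\<bar>x * y * z\<bar> \<le> m * m * m"
    unfolding abs_mult m_def by (intro mult_mono) auto
  also have "\<dots> = m ^ 3" by (simp add: power3_eq_cube)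
  also have "m ^ 3 \<le> \<bar>x\<bar> ^ 3 + \<bar>y\<bar> ^ 3 + \<bar>z\<bar> ^ 3"
    unfolding m_def by (auto simp: max_def)
  finally show ?thesis .
qed

lemma L3_bounded_by:
  assumes "L3 M g" "f \<in> borel_measurable M" "\<And>\<omega>. \<bar>f \<omega>\<bar> \<le> \<bar>g \<omega>\<bar>"
  shows "L3 M f"
  unfolding L3_def
proof
  show "integrable M (\<lambda>\<omega>. \<bar>f \<omega>\<bar> ^ 3)"
    by (rule Bochner_Integration.integrable_bound[where f = "\<lambda>\<omega>. \<bar>g \<omega>\<bar> ^ 3"])
       (use assms in \<open>auto simp: L3_def intro!: power_mono\<close>)
qed fact

lemma L3_cong_AE:
  assumes "L3 M f" "AE \<omega> in M. f \<omega> = g \<omega>" "g \<in> borel_measurable M"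
  shows "L3 M g"
proof -
  note [measurable] = assms(3) L3_measurable[OF assms(1)]
  have "integrable M (\<lambda>\<omega>. \<bar>f \<omega>\<bar> ^ 3) \<longleftrightarrow> integrable M (\<lambda>\<omega>. \<bar>g \<omega>\<bar> ^ 3)"
    using assms(2) by (intro integrable_cong_AE) auto
  then show ?thesis using assms by (simp add: L3_def)
qed

lemma square_integrable_diff:
  fixes f g :: "'a \<Rightarrow> real"
  assumes [measurable]: "f \<in> borel_measurable M" "g \<in> borel_measurable M"
    and int: "integrable M (\<lambda>\<omega>. (f \<omega>)\<^sup>2)" "integrable M (\<lambda>\<omega>. (g \<omega>)\<^sup>2)"
  shows "integrable M (\<lambda>\<omega>. (f \<omega> - g \<omega>)\<^sup>2)"
proof (rule Bochner_Integration.integrable_bound[where f = "\<lambda>\<omega>. 2 * (f \<omega>)\<^sup>2 + 2 * (g \<omega>)\<^sup>2"])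
  show "integrable M (\<lambda>\<omega>. 2 * (f \<omega>)\<^sup>2 + 2 * (g \<omega>)\<^sup>2)" using int by simp
  have "(x - y)\<^sup>2 \<le> 2 * x\<^sup>2 + 2 * y\<^sup>2" for x y :: real
    using zero_le_power2[of "x + y"] by (simp add: power2_eq_square algebra_simps)
  then show "AE \<omega> in M. norm ((f \<omega> - g \<omega>)\<^sup>2) \<le> norm (2 * (f \<omega>)\<^sup>2 + 2 * (g \<omega>)\<^sup>2)"
    by simp
qed measurable

lemma L3_add: "L3 M f \<Longrightarrow> L3 M g \<Longrightarrow> L3 M (\<lambda>\<omega>. f \<omega> + g \<omega>)"
  unfolding L3_def
proof safe
  assume [measurable]: "f \<in> borel_measurable M" "g \<in> borel_measurable M"
    and int: "integrable M (\<lambda>\<omega>. \<bar>f \<omega>\<bar> ^ 3)" "integrable M (\<lambda>\<omega>. \<bar>g \<omega>\<bar> ^ 3)"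
  show "integrable M (\<lambda>\<omega>. \<bar>f \<omega> + g \<omega>\<bar> ^ 3)"
    by (rule Bochner_Integration.integrable_bound[where f = "\<lambda>\<omega>. 8 * (\<bar>f \<omega>\<bar> ^ 3 + \<bar>g \<omega>\<bar> ^ 3)"])
       (use int abs_cube_add_le in \<open>auto simp: distrib_left\<close>)
qed auto

lemma L3_cmult: "L3 M f \<Longrightarrow> L3 M (\<lambda>\<omega>. k * f \<omega>)"
  by (auto simp: L3_def abs_mult power_mult_distrib)

lemma L3_diff: "L3 M f \<Longrightarrow> L3 M g \<Longrightarrow> L3 M (\<lambda>\<omega>. f \<omega> - g \<omega>)"
  using L3_add[of M f "\<lambda>\<omega>. (-1) * g \<omega>"] L3_cmult[of M g "-1"] by simp

lemma L3_zero: "L3 M (\<lambda>_. 0)"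
  by (simp add: L3_def)

lemma L3_sum: "(\<And>i. i \<in> I \<Longrightarrow> L3 M (f i)) \<Longrightarrow> L3 M (\<lambda>\<omega>. \<Sum>i\<in>I. f i \<omega>)"
  by (induction I rule: infinite_finite_induct) (auto intro: L3_zero L3_add)

lemma (in finite_measure) L3_const: "L3 M (\<lambda>_. k)"
  by (simp add: L3_def)

lemma L3_mult3_integrable:
  assumes "L3 M f" "L3 M g" "L3 M h"
  shows "integrable M (\<lambda>\<omega>. f \<omega> * g \<omega> * h \<omega>)"
  by (rule Bochner_Integration.integrable_bound
        [where f = "\<lambda>\<omega>. \<bar>f \<omega>\<bar> ^ 3 + \<bar>g \<omega>\<bar> ^ 3 + \<bar>h \<omega>\<bar> ^ 3"])
     (use assms in \<open>auto simp: L3_def abs_mult3_le\<close>)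

lemma (in finite_measure) L3_mult2_integrable:
  "L3 M f \<Longrightarrow> L3 M g \<Longrightarrow> integrable M (\<lambda>\<omega>. f \<omega> * g \<omega>)"
  using L3_mult3_integrable[OF _ _ L3_const[of 1]] by simp

lemma (in finite_measure) L3_integrable: "L3 M f \<Longrightarrow> integrable M f"
  using L3_mult3_integrable[OF _ L3_const[of 1] L3_const[of 1]] by simp

text \<open>The tangent-line inequality at \<open>y\<close> for the convex function
  \<open>\<bar>z\<bar> ^ 3\<close>, whose derivative is
  \<open>3 * z * \<bar>z\<bar>\<close>.\<close>

lemma abs_cube_add_ge: "\<bar>x + y\<bar> ^ 3 \<ge> \<bar>y\<bar> ^ 3 + 3 * (x * y * \<bar>y\<bar>)" for x y :: real
proof -
  define u where "u = \<bar>x + y\<bar>"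
  define v where "v = \<bar>y\<bar>"
  have uv: "u \<ge> 0" "v \<ge> 0" by (auto simp: u_def v_def)
  have "(x + y) * y \<le> u * v"
    unfolding u_def v_def abs_mult[symmetric] by (rule abs_ge_self)
  then have "x * y \<le> u * v - v\<^sup>2"
    by (simp add: algebra_simps v_def power2_eq_square)
  then have "x * y * v \<le> (u * v - v\<^sup>2) * v"
    using uv by (intro mult_right_mono)
  \<comment> \<open>The product expands to
    \<open>u ^ 3 - 3 * u * v\<^sup>2 + 2 * v ^ 3\<close>.\<close>
  moreover have "0 \<le> (u - v)\<^sup>2 * (u + 2 * v)" using uv by simp
  ultimately have "v ^ 3 + 3 * (x * y * v) \<le> u ^ 3"
    by (simp add: algebra_simps power2_eq_square power3_eq_cube)
  then show ?thesis by (simp add: u_def v_def)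
qed

text \<open>For \<open>x\<^sup>2 > K\<close> the larger of \<open>\<bar>x\<bar>\<close> and
  \<open>\<delta> * \<bar>y\<bar>\<close> dominates; otherwise \<open>K * \<bar>y\<bar>\<close> is
  split by a weighted AM-GM inequality. The right-hand side is made for integration:
  \<open>\<delta>\<close> is fixed first, then \<open>K\<close> makes the tail of
  \<open>\<bar>x\<bar> ^ 3\<close> small, and finally the second moment of \<open>y\<close> tends to
  0.\<close>

lemma sq_mult_abs_le:
  fixes x y \<delta> K :: real
  assumes \<delta>: "\<delta> > 0"
  shows "x\<^sup>2 * \<bar>y\<bar> \<le> \<delta> + K\<^sup>2 / (4 * \<delta>) * y\<^sup>2
    + (1 / \<delta>) * (\<bar>x\<bar> ^ 3 * indicator {x. x\<^sup>2 > K} x) + \<delta>\<^sup>2 * \<bar>y\<bar> ^ 3"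
proof (cases "x\<^sup>2 > K")
  case True
  have "x\<^sup>2 * \<bar>y\<bar> \<le> (1 / \<delta>) * \<bar>x\<bar> ^ 3 + \<delta>\<^sup>2 * \<bar>y\<bar> ^ 3"
  proof (cases "\<delta> * \<bar>y\<bar> \<le> \<bar>x\<bar>")
    case True
    then have "x\<^sup>2 * \<bar>y\<bar> \<le> x\<^sup>2 * (\<bar>x\<bar> / \<delta>)"
      using \<delta> by (intro mult_left_mono) (auto simp: field_simps)
    also have "\<dots> = (1 / \<delta>) * \<bar>x\<bar> ^ 3"
      by (simp add: power3_eq_cube power2_eq_square abs_mult_self_eq)
    finally show ?thesis using \<delta> by (simp add: add_increasing2)
  next
    case False
    then have "\<bar>x\<bar>\<^sup>2 * \<bar>y\<bar> \<le> (\<delta> * \<bar>y\<bar>)\<^sup>2 * \<bar>y\<bar>"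
      by (intro mult_right_mono power_mono) auto
    then have "x\<^sup>2 * \<bar>y\<bar> \<le> \<delta>\<^sup>2 * \<bar>y\<bar> ^ 3"
      by (simp add: power_mult_distrib power3_eq_cube power2_eq_square mult_ac)
    then show ?thesis using \<delta> by (simp add: add_increasing)
  qed
  moreover have "0 \<le> \<delta> + K\<^sup>2 / (4 * \<delta>) * y\<^sup>2" using \<delta> by simp
  ultimately show ?thesis using True by simp
next
  case False
  have "0 \<le> (K * \<bar>y\<bar> - 2 * \<delta>)\<^sup>2" by simp
  then have "4 * \<delta> * (K * \<bar>y\<bar>) \<le> K\<^sup>2 * y\<^sup>2 + 4 * \<delta> * \<delta>"
    by (simp add: power2_diff power_mult_distrib algebra_simps power2_eq_square)
  then have "K * \<bar>y\<bar> \<le> \<delta> + K\<^sup>2 / (4 * \<delta>) * y\<^sup>2"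
    using \<delta> by (simp add: field_simps)
  moreover have "x\<^sup>2 * \<bar>y\<bar> \<le> K * \<bar>y\<bar>"
    using False by (intro mult_right_mono) auto
  moreover have "0 \<le> \<delta>\<^sup>2 * \<bar>y\<bar> ^ 3" by simp
  ultimately have "x\<^sup>2 * \<bar>y\<bar> \<le> \<delta> + K\<^sup>2 / (4 * \<delta>) * y\<^sup>2 + \<delta>\<^sup>2 * \<bar>y\<bar> ^ 3"
    by linarith
  then show ?thesis using False by simp
qed

text \<open>Convergence of \<open>Y n\<close> in mean square alone would not do, because the square
  of \<open>R\<close> need not be square integrable. Truncating \<open>R\<close> repairs this, with
  the uniform third moment bound controlling \<open>Y n\<close> where \<open>R\<close> is
  large.\<close>

lemma (in prob_space) L3_weighted_limit_0:
  fixes R :: "'a \<Rightarrow> real" and Y :: "nat \<Rightarrow> 'a \<Rightarrow> real"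
  assumes R: "L3 M R" and Y: "\<And>n. L3 M (Y n)"
    and bound: "\<And>n. (\<integral>\<omega>. \<bar>Y n \<omega>\<bar> ^ 3 \<partial>M) \<le> C"
    and lim: "(\<lambda>n. \<integral>\<omega>. (Y n \<omega>)\<^sup>2 \<partial>M) \<longlonglongrightarrow> 0"
  shows "(\<lambda>n. \<integral>\<omega>. (R \<omega>)\<^sup>2 * Y n \<omega> \<partial>M) \<longlonglongrightarrow> 0"
proof (rule LIMSEQ_I)
  fix e :: real assume e: "e > 0"
  have [measurable]: "R \<in> borel_measurable M" "\<And>n. Y n \<in> borel_measurable M"
    using R Y by (auto simp: L3_def)
  have C0: "C \<ge> 0" using bound[of 0] by (rule order_trans[rotated]) (simp add: integral_nonneg)
  \<comment> \<open>With \<open>\<delta> \<le> 1\<close> one has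
    \<open>\<delta>\<^sup>2 \<le> \<delta>\<close>, so the two terms without a limit in
    \<open>n\<close> or \<open>K\<close> add up to at most \<open>e / 4\<close>.\<close>
  define \<delta> where "\<delta> = min 1 (e / (4 * (1 + C)))"
  have \<delta>: "\<delta> > 0" "\<delta> \<le> 1" using e C0 by (auto simp: \<delta>_def)
  have "\<delta> \<le> e / (4 * (1 + C))" by (simp add: \<delta>_def)
  then have "\<delta> * (1 + C) \<le> e / 4" using C0 by (simp add: field_simps)
  moreover have "\<delta>\<^sup>2 * C \<le> \<delta> * C" using \<delta> C0
    by (intro mult_right_mono) (auto simp: power2_eq_square intro: mult_left_le)
  ultimately have small: "\<delta> + \<delta>\<^sup>2 * C \<le> e / 4" by (simp add: algebra_simps)
  let ?T = "\<lambda>n \<omega>. \<bar>R \<omega>\<bar> ^ 3 * indicator {x. x\<^sup>2 > real n} (R \<omega>)"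
  have Tmeas[measurable]: "?T n \<in> borel_measurable M" for n by measurable
  have Tint: "integrable M (?T n)" for n
    by (rule Bochner_Integration.integrable_bound[where f = "\<lambda>\<omega>. \<bar>R \<omega>\<bar> ^ 3"])
       (use R in \<open>auto simp: L3_def indicator_def\<close>)
  have "(\<lambda>n. integral\<^sup>L M (?T n)) \<longlonglongrightarrow> integral\<^sup>L M (\<lambda>_. 0 :: real)"
  proof (rule integral_dominated_convergence[where w = "\<lambda>\<omega>. \<bar>R \<omega>\<bar> ^ 3"])
    show "AE \<omega> in M. (\<lambda>n. ?T n \<omega>) \<longlonglongrightarrow> 0"
    proof (rule AE_I2)
      fix \<omega>
      obtain N :: nat where N: "(R \<omega>)\<^sup>2 \<le> real N" using real_arch_simple by blast
      have "eventually (\<lambda>n. ?T n \<omega> = 0) sequentially"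
        using eventually_ge_at_top[of N] by eventually_elim (use N in \<open>auto simp: indicator_def\<close>)
      then show "(\<lambda>n. ?T n \<omega>) \<longlonglongrightarrow> 0" by (rule tendsto_eventually)
    qed
  qed (use R in \<open>auto simp: L3_def indicator_def\<close>)
  \<comment> \<open>The factor \<open>\<delta>\<close> compensates the weight
    \<open>1 / \<delta>\<close> of the tail term.\<close>
  then have "eventually (\<lambda>n. integral\<^sup>L M (?T n) < \<delta> * (e / 4)) sequentially"
    using \<delta> e by (intro order_tendstoD) auto
  then obtain K :: nat where K: "integral\<^sup>L M (?T K) < \<delta> * (e / 4)"
    by (auto simp: eventually_sequentially)
  have "(\<lambda>n. (real K)\<^sup>2 / (4 * \<delta>) * (\<integral>\<omega>. (Y n \<omega>)\<^sup>2 \<partial>M)) \<longlonglongrightarrow> (real K)\<^sup>2 / (4 * \<delta>) * 0"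
    by (intro tendsto_mult_left lim)
  then have "eventually (\<lambda>n. (real K)\<^sup>2 / (4 * \<delta>) * (\<integral>\<omega>. (Y n \<omega>)\<^sup>2 \<partial>M) < e / 4) sequentially"
    using e by (intro order_tendstoD) auto
  then obtain N where N: "\<And>n. n \<ge> N \<Longrightarrow> (real K)\<^sup>2 / (4 * \<delta>) * (\<integral>\<omega>. (Y n \<omega>)\<^sup>2 \<partial>M) < e / 4"
    by (auto simp: eventually_sequentially)
  show "\<exists>N. \<forall>n\<ge>N. norm ((\<integral>\<omega>. (R \<omega>)\<^sup>2 * Y n \<omega> \<partial>M) - 0) < e"
  proof (intro exI allI impI)
    fix n assume n: "n \<ge> N"
    have Y2: "integrable M (\<lambda>\<omega>. (Y n \<omega>)\<^sup>2)"
      using L3_mult2_integrable[OF Y Y] by (simp add: power2_eq_square)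
    have Y3: "integrable M (\<lambda>\<omega>. \<bar>Y n \<omega>\<bar> ^ 3)" using Y by (simp add: L3_def)
    have RY: "integrable M (\<lambda>\<omega>. (R \<omega>)\<^sup>2 * Y n \<omega>)"
      using L3_mult3_integrable[OF R R Y] by (simp add: power2_eq_square)
    have "norm (\<integral>\<omega>. (R \<omega>)\<^sup>2 * Y n \<omega> \<partial>M) \<le> (\<integral>\<omega>. (R \<omega>)\<^sup>2 * \<bar>Y n \<omega>\<bar> \<partial>M)"
      by (rule order_trans[OF integral_norm_bound]) (simp add: abs_mult)
    also have "\<dots> \<le> (\<integral>\<omega>. \<delta> + (real K)\<^sup>2 / (4 * \<delta>) * (Y n \<omega>)\<^sup>2 + (1 / \<delta>) * ?T K \<omega>
        + \<delta>\<^sup>2 * \<bar>Y n \<omega>\<bar> ^ 3 \<partial>M)"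
    proof (rule integral_mono)
      show "integrable M (\<lambda>\<omega>. (R \<omega>)\<^sup>2 * \<bar>Y n \<omega>\<bar>)"
        using integrable_abs[OF RY] by (simp add: abs_mult)
      show "integrable M (\<lambda>\<omega>. \<delta> + (real K)\<^sup>2 / (4 * \<delta>) * (Y n \<omega>)\<^sup>2 + (1 / \<delta>) * ?T K \<omega>
        + \<delta>\<^sup>2 * \<bar>Y n \<omega>\<bar> ^ 3)"
        by (intro Bochner_Integration.integrable_add integrable_mult_right Y2 Y3 Tint) simp
    qed (rule sq_mult_abs_le[OF \<delta>(1)])
    also have "\<dots> = \<delta> + (real K)\<^sup>2 / (4 * \<delta>) * (\<integral>\<omega>. (Y n \<omega>)\<^sup>2 \<partial>M)
        + (1 / \<delta>) * integral\<^sup>L M (?T K) + \<delta>\<^sup>2 * (\<integral>\<omega>. \<bar>Y n \<omega>\<bar> ^ 3 \<partial>M)"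
      using Y2 Y3 Tint by (simp add: prob_space)
    also have "\<dots> < \<delta> + e / 4 + e / 4 + \<delta>\<^sup>2 * C"
    proof -
      have "(1 / \<delta>) * integral\<^sup>L M (?T K) < e / 4"
        using K \<delta> by (simp add: field_simps)
      moreover have "\<delta>\<^sup>2 * (\<integral>\<omega>. \<bar>Y n \<omega>\<bar> ^ 3 \<partial>M) \<le> \<delta>\<^sup>2 * C"
        by (intro mult_left_mono bound) simp
      ultimately show ?thesis using N[OF n] by linarith
    qed
    also have "\<dots> \<le> e" using small e by simp
    finally show "norm ((\<integral>\<omega>. (R \<omega>)\<^sup>2 * Y n \<omega> \<partial>M) - 0) < e" by simp
  qed
qed

text \<open>By independence the third absolute moment of the product factorises. Working with
  nonnegative integrals allows an infinite factor a priori; as the moment of \<open>Z\<close> is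
  nonzero, that of \<open>T\<close> must be finite.\<close>

lemma (in prob_space) indep_var_mult_L3_right:
  fixes Z T :: "'a \<Rightarrow> real"
  assumes indep: "indep_var borel Z borel T"
    and Z: "\<not> (AE \<omega> in M. Z \<omega> = 0)"
    and ZT: "L3 M (\<lambda>\<omega>. Z \<omega> * T \<omega>)"
  shows "L3 M T"
proof -
  have [measurable]: "Z \<in> borel_measurable M" "T \<in> borel_measurable M"
    using indep by (auto dest: indep_var_rv1 indep_var_rv2)
  let ?f = "\<lambda>x::real. ennreal (\<bar>x\<bar> ^ 3)"
  have "indep_var borel (?f \<circ> Z) borel (?f \<circ> T)"
    by (rule indep_var_compose[OF indep]) auto
  moreover have "case_bool borel borel = (\<lambda>_::bool. borel :: ennreal measure)"
    by (rule ext) (simp split: bool.split)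
  ultimately have iv: "indep_vars (\<lambda>_. borel) (case_bool (?f \<circ> Z) (?f \<circ> T)) UNIV"
    unfolding indep_var_def by simp
  have "(\<integral>\<^sup>+\<omega>. ?f (Z \<omega>) \<partial>M) * (\<integral>\<^sup>+\<omega>. ?f (T \<omega>) \<partial>M) = (\<integral>\<^sup>+\<omega>. ?f (Z \<omega> * T \<omega>) \<partial>M)"
    using indep_vars_nn_integral[OF _ iv]
    by (simp add: UNIV_bool abs_mult power_mult_distrib ennreal_mult mult.commute comp_def)
  also have "\<dots> < \<infinity>"
    using ZT by (simp add: L3_def integrable_iff_bounded)
  finally have fin: "(\<integral>\<^sup>+\<omega>. ?f (Z \<omega>) \<partial>M) * (\<integral>\<^sup>+\<omega>. ?f (T \<omega>) \<partial>M) < \<infinity>" .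
  have "(\<integral>\<^sup>+\<omega>. ?f (Z \<omega>) \<partial>M) \<noteq> 0"
    using Z by (subst nn_integral_0_iff_AE) auto
  with fin have "(\<integral>\<^sup>+\<omega>. ?f (T \<omega>) \<partial>M) < \<infinity>"
    by (auto simp: ennreal_mult_eq_top_iff less_top[symmetric])
  then show ?thesis
    by (simp add: L3_def integrable_iff_bounded)
qed

section \<open>The model, its filtration and independence of the past\<close>

text \<open>\<open>X t\<close> is a chosen version of the mean-square sum of the series. Such a
  limit is determined only up to null sets, so the equation for \<open>r\<close> is imposed almost
  everywhere.\<close>

locale quadratic_arch = prob_space M for M :: "'a measure" +
  fixes \<zeta> r X :: "int \<Rightarrow> 'a \<Rightarrow> real"
    and a c :: real
    and b :: "nat \<Rightarrow> real"
  assumes zeta_rv: "\<zeta> t \<in> borel_measurable M"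
    and zeta_indep: "indep_vars (\<lambda>_. borel) \<zeta> UNIV"
    and zeta_id: "distr M borel (\<zeta> t) = distr M borel (\<zeta> 0)"
    and zeta_int: "integrable M (\<zeta> 0)"
    and zeta_mean: "(\<integral>\<omega>. \<zeta> 0 \<omega> \<partial>M) = 0"
    and zeta_sq_int: "integrable M (\<lambda>\<omega>. (\<zeta> 0 \<omega>)\<^sup>2)"
    and zeta_var: "(\<integral>\<omega>. (\<zeta> 0 \<omega>)\<^sup>2 \<partial>M) = 1"
    and zeta_abs3: "integrable M (\<lambda>\<omega>. \<bar>\<zeta> 0 \<omega>\<bar> ^ 3)"
    and zeta_mu3: "(\<integral>\<omega>. (\<zeta> 0 \<omega>) ^ 3 \<partial>M) = 0"
    and r_adapted: "r t \<in> borel_measurable (nat_filtration M \<zeta> t)"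
    and r_rv: "r t \<in> borel_measurable M"
    and X_lim: "L2_limit M (\<lambda>n \<omega>. \<Sum>j=1..n. b j * r (t - int j) \<omega>) (X t)"
    and r_eq: "AE \<omega> in M. r t \<omega> = \<zeta> t \<omega> * sqrt (c\<^sup>2 + (a + X t \<omega>)\<^sup>2)"
    and r_stat: "strictly_stationary M r"
    and r_abs3: "integrable M (\<lambda>\<omega>. \<bar>r 0 \<omega>\<bar> ^ 3)"
begin

abbreviation \<F> :: "int \<Rightarrow> 'a measure" where
  "\<F> \<equiv> nat_filtration M \<zeta>"

abbreviation innov_events :: "int \<Rightarrow> 'a set set" where
  "innov_events s \<equiv> {\<zeta> s -` A \<inter> space M | A. A \<in> sets borel}"

lemma space_F: "space (\<F> t) = space M"
  unfolding nat_filtration_def by (rule space_measure_of) auto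

lemma sets_F: "sets (\<F> t) = sigma_sets (space M) (\<Union>s\<in>{..t}. innov_events s)"
  unfolding nat_filtration_def by (rule sets_measure_of) auto

lemma sets_F_mono: "s \<le> t \<Longrightarrow> sets (\<F> s) \<subseteq> sets (\<F> t)"
  unfolding sets_F by (intro sigma_sets_mono' UN_mono) auto

lemma sets_F_le: "sets (\<F> t) \<subseteq> sets M"
  unfolding sets_F using zeta_rv by (intro sets.sigma_sets_subset) auto

lemma measurable_F_mono: "s \<le> t \<Longrightarrow> f \<in> borel_measurable (\<F> s) \<Longrightarrow> f \<in> borel_measurable (\<F> t)"
  using sets_F_mono by (auto simp: measurable_def space_F)

lemma measurable_F_M: "f \<in> borel_measurable (\<F> s) \<Longrightarrow> f \<in> borel_measurable M"
  using sets_F_le by (auto simp: measurable_def space_F)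

text \<open>Measurability up to null sets: \<open>X t\<close> is only an \<open>L\<^sup>2\<close>-limit, and neither \<open>M\<close> nor the
  filtration is assumed complete.\<close>
definition past :: "int \<Rightarrow> ('a \<Rightarrow> real) \<Rightarrow> bool" where
  "past s f \<longleftrightarrow> f \<in> borel_measurable M \<and>
     (\<exists>g\<in>borel_measurable (\<F> s). AE \<omega> in M. f \<omega> = g \<omega>)"

lemma past_measurable: "past s f \<Longrightarrow> f \<in> borel_measurable M"
  by (simp add: past_def)

lemma past_mono: "past s f \<Longrightarrow> s \<le> t \<Longrightarrow> past t f"
  unfolding past_def using measurable_F_mono by blast

lemma past_r: "s \<le> t \<Longrightarrow> past t (r s)"
  by (rule past_mono[of s]) (auto simp: past_def r_rv intro: r_adapted)

lemma past_compose2: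
  assumes "past s f" "past s g"
    and [measurable]: "(\<lambda>p. \<phi> (fst p) (snd p)) \<in> borel_measurable (borel \<Otimes>\<^sub>M borel)"
  shows "past s (\<lambda>\<omega>. \<phi> (f \<omega>) (g \<omega>))"
proof -
  obtain f' g' where f': "f' \<in> borel_measurable (\<F> s)" "AE \<omega> in M. f \<omega> = f' \<omega>"
    and g': "g' \<in> borel_measurable (\<F> s)" "AE \<omega> in M. g \<omega> = g' \<omega>"
    using assms(1,2) unfolding past_def by blast
  have comp: "(\<lambda>\<omega>. \<phi> (u \<omega>) (v \<omega>)) \<in> borel_measurable N"
    if "u \<in> borel_measurable N" "v \<in> borel_measurable N" for u v and N :: "'a measure"
    using measurable_compose[OF measurable_Pair[OF that] assms(3)] by simp
  show ?thesis
    unfolding past_def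
  proof (intro conjI bexI)
    show "AE \<omega> in M. \<phi> (f \<omega>) (g \<omega>) = \<phi> (f' \<omega>) (g' \<omega>)"
      using f'(2) g'(2) by eventually_elim simp
  qed (use assms(1,2) f' g' in \<open>auto intro!: comp dest: past_measurable\<close>)
qed

lemma past_compose:
  assumes "past s f" "\<phi> \<in> borel_measurable borel"
  shows "past s (\<lambda>\<omega>. \<phi> (f \<omega>))"
  by (rule past_compose2[OF assms(1,1), of "\<lambda>x _. \<phi> x"]) (use assms(2) in measurable)

lemma past_mult: "past s f \<Longrightarrow> past s g \<Longrightarrow> past s (\<lambda>\<omega>. f \<omega> * g \<omega>)"
  by (rule past_compose2) measurable

text \<open>The index blocks \<open>{s}\<close> and \<open>{..s - 1}\<close> are disjoint, so the
  sigma-algebras generated by their innovations are independent, and \<open>g\<close> is measurable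
  with respect to the second.\<close>

lemma indep_innov:
  assumes g: "g \<in> borel_measurable (\<F> (s - 1))"
  shows "indep_var borel (\<zeta> s) borel g"
proof -
  let ?I = "case_bool {s} {..s - 1}"
  have "indep_sets (\<lambda>j. sigma_sets (space M) (\<Union>i\<in>?I j. innov_events i)) UNIV"
  proof (rule indep_sets_collect_sigma)
    show "indep_sets innov_events (\<Union>j\<in>UNIV. ?I j)"
      by (rule indep_sets_mono_index[of _ UNIV]) (use zeta_indep in \<open>simp_all add: indep_vars_def2\<close>)
    show "Int_stable (innov_events i)" for i
    proof (rule Int_stableI)
      fix U V assume "U \<in> innov_events i" "V \<in> innov_events i"
      then obtain A B where "U = \<zeta> i -` A \<inter> space M" "V = \<zeta> i -` B \<inter> space M"
        and AB: "A \<in> sets borel" "B \<in> sets borel" by blast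
      then have "U \<inter> V = \<zeta> i -` (A \<inter> B) \<inter> space M" by blast
      with AB show "U \<inter> V \<in> innov_events i" by blast
    qed
    show "disjoint_family_on ?I UNIV"
      by (auto simp: disjoint_family_on_def split: bool.splits)
  qed
  then have "indep_sets (case_bool
      (sigma_sets (space M) (innov_events s))
      (sigma_sets (space M) {g -` A \<inter> space M | A. A \<in> sets borel})) UNIV"
  proof (rule indep_sets_mono_sets)
    have "sigma_sets (space M) {g -` A \<inter> space M | A. A \<in> sets borel} \<subseteq> sets (\<F> (s - 1))"
      using measurable_sets[OF g] sets.sigma_sets_subset[of "{g -` A \<inter> space M | A. A \<in> sets borel}" "\<F> (s - 1)"]
      by (auto simp: space_F)
    then show "case_bool (sigma_sets (space M) (innov_events s))
        (sigma_sets (space M) {g -` A \<inter> space M | A. A \<in> sets borel}) j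
        \<subseteq> sigma_sets (space M) (\<Union>i\<in>?I j. innov_events i)" for j
      by (cases j) (simp_all add: sets_F)
  qed
  then show ?thesis
    unfolding indep_var_eq indep_set_def
    using zeta_rv measurable_F_M[OF g] by simp
qed

lemma
  assumes [measurable]: "\<phi> \<in> borel_measurable borel"
  shows zeta_integrable_iff: "integrable M (\<lambda>\<omega>. \<phi> (\<zeta> t \<omega>) :: real) \<longleftrightarrow> integrable M (\<lambda>\<omega>. \<phi> (\<zeta> 0 \<omega>))"
    and zeta_integral: "(\<integral>\<omega>. \<phi> (\<zeta> t \<omega>) \<partial>M) = (\<integral>\<omega>. \<phi> (\<zeta> 0 \<omega>) \<partial>M)"
proof -
  have "integrable M (\<lambda>\<omega>. \<phi> (\<zeta> t \<omega>)) = integrable (distr M borel (\<zeta> t)) \<phi>"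
    by (rule integrable_distr_eq[OF zeta_rv assms, symmetric])
  also have "\<dots> = integrable (distr M borel (\<zeta> 0)) \<phi>" by (simp only: zeta_id[of t])
  also have "\<dots> = integrable M (\<lambda>\<omega>. \<phi> (\<zeta> 0 \<omega>))"
    by (rule integrable_distr_eq[OF zeta_rv assms])
  finally show "integrable M (\<lambda>\<omega>. \<phi> (\<zeta> t \<omega>)) = integrable M (\<lambda>\<omega>. \<phi> (\<zeta> 0 \<omega>))" .
  have "(\<integral>\<omega>. \<phi> (\<zeta> t \<omega>) \<partial>M) = integral\<^sup>L (distr M borel (\<zeta> t)) \<phi>"
    by (rule integral_distr[OF zeta_rv assms, symmetric])
  also have "\<dots> = integral\<^sup>L (distr M borel (\<zeta> 0)) \<phi>" by (simp only: zeta_id[of t])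
  also have "\<dots> = (\<integral>\<omega>. \<phi> (\<zeta> 0 \<omega>) \<partial>M)"
    by (rule integral_distr[OF zeta_rv assms])
  finally show "(\<integral>\<omega>. \<phi> (\<zeta> t \<omega>) \<partial>M) = (\<integral>\<omega>. \<phi> (\<zeta> 0 \<omega>) \<partial>M)" .
qed

text \<open>This replaces conditional expectations: with \<open>\<phi>\<close> the first, second and
  third power it expresses that the innovation has conditional moments 0, 1 and 0 given the
  past.\<close>

lemma zeta_past_integral:
  assumes f: "past (s - 1) f" "integrable M f"
    and \<phi>: "\<phi> \<in> borel_measurable borel" "integrable M (\<lambda>\<omega>. \<phi> (\<zeta> 0 \<omega>) :: real)"
  shows "(\<integral>\<omega>. \<phi> (\<zeta> s \<omega>) * f \<omega> \<partial>M) = (\<integral>\<omega>. \<phi> (\<zeta> 0 \<omega>) \<partial>M) * (\<integral>\<omega>. f \<omega> \<partial>M)"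
proof -
  obtain g where g: "g \<in> borel_measurable (\<F> (s - 1))" "AE \<omega> in M. f \<omega> = g \<omega>"
    using f(1) unfolding past_def by blast
  note [measurable] = past_measurable[OF f(1)] measurable_F_M[OF g(1)] zeta_rv \<phi>(1)
  have "indep_var borel (\<phi> \<circ> \<zeta> s) borel (id \<circ> g)"
    using \<phi> by (intro indep_var_compose[OF indep_innov[OF g(1)]]) auto
  then have iv: "indep_var borel (\<lambda>\<omega>. \<phi> (\<zeta> s \<omega>)) borel g" by (simp add: comp_def)
  have gint: "integrable M g"
    using integrable_cong_AE[of f M g] f(2) g(2) by simp
  have \<phi>int: "integrable M (\<lambda>\<omega>. \<phi> (\<zeta> s \<omega>))"
    using zeta_integrable_iff[OF \<phi>(1), of s] \<phi>(2) by (rule iffD2)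
  have "(\<integral>\<omega>. \<phi> (\<zeta> s \<omega>) * f \<omega> \<partial>M) = (\<integral>\<omega>. \<phi> (\<zeta> s \<omega>) * g \<omega> \<partial>M)"
  proof (rule integral_cong_AE)
    show "AE \<omega> in M. \<phi> (\<zeta> s \<omega>) * f \<omega> = \<phi> (\<zeta> s \<omega>) * g \<omega>"
      using g(2) by eventually_elim simp
  qed measurable
  also have "\<dots> = (\<integral>\<omega>. \<phi> (\<zeta> s \<omega>) \<partial>M) * (\<integral>\<omega>. g \<omega> \<partial>M)"
    by (rule indep_var_lebesgue_integral[OF iv \<phi>int gint])
  also have "(\<integral>\<omega>. \<phi> (\<zeta> s \<omega>) \<partial>M) = (\<integral>\<omega>. \<phi> (\<zeta> 0 \<omega>) \<partial>M)"
    by (rule zeta_integral[OF \<phi>(1)])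
  also have "(\<integral>\<omega>. g \<omega> \<partial>M) = (\<integral>\<omega>. f \<omega> \<partial>M)"
    using g(2) by (intro integral_cong_AE) (auto elim: eventually_mono)
  finally show ?thesis .
qed

section \<open>Consequences of stationarity\<close>

lemma
  assumes I: "finite I" and \<phi>[measurable]: "\<phi> \<in> borel_measurable (PiM I (\<lambda>_. borel))"
  shows stationary_integrable: "integrable M (\<lambda>\<omega>. \<phi> (\<lambda>i\<in>I. r (i + t) \<omega>) :: real) \<longleftrightarrow>
      integrable M (\<lambda>\<omega>. \<phi> (\<lambda>i\<in>I. r i \<omega>))"
    and stationary_integral: "(\<integral>\<omega>. \<phi> (\<lambda>i\<in>I. r (i + t) \<omega>) \<partial>M) = (\<integral>\<omega>. \<phi> (\<lambda>i\<in>I. r i \<omega>) \<partial>M)"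
proof -
  have m: "(\<lambda>\<omega>. \<lambda>i\<in>I. r (i + h) \<omega>) \<in> measurable M (PiM I (\<lambda>_. borel))" for h
    by (intro measurable_restrict r_rv)
  have eq: "distr M (PiM I (\<lambda>_. borel)) (\<lambda>\<omega>. \<lambda>i\<in>I. r (i + t) \<omega>) =
      distr M (PiM I (\<lambda>_. borel)) (\<lambda>\<omega>. \<lambda>i\<in>I. r i \<omega>)"
    using r_stat I unfolding strictly_stationary_def by blast
  show "integrable M (\<lambda>\<omega>. \<phi> (\<lambda>i\<in>I. r (i + t) \<omega>)) \<longleftrightarrow> integrable M (\<lambda>\<omega>. \<phi> (\<lambda>i\<in>I. r i \<omega>))"
    using integrable_distr_eq[OF m \<phi>, of t] integrable_distr_eq[OF m \<phi>, of 0] eq by simp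
  show "(\<integral>\<omega>. \<phi> (\<lambda>i\<in>I. r (i + t) \<omega>) \<partial>M) = (\<integral>\<omega>. \<phi> (\<lambda>i\<in>I. r i \<omega>) \<partial>M)"
    using integral_distr[OF m \<phi>, of t] integral_distr[OF m \<phi>, of 0] eq by simp
qed

lemma L3_r: "L3 M (r t)"
  using stationary_integrable[of "{0}" "\<lambda>x. \<bar>x 0\<bar> ^ 3" t] r_abs3 r_rv by (simp add: L3_def)

lemma expect_r_sq: "(\<integral>\<omega>. (r t \<omega>)\<^sup>2 \<partial>M) = (\<integral>\<omega>. (r 0 \<omega>)\<^sup>2 \<partial>M)"
  using stationary_integral[of "{0}" "\<lambda>x. (x 0)\<^sup>2" t] by simp

text \<open>For \<open>j \<ge> 1\<close> this is the leverage covariance, see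
  \<open>cov_eq_h\<close>. Written in terms of \<open>r\<close> alone, it is independent of time by
  the stationarity of \<open>r\<close>, without any joint law of \<open>X\<close> and
  \<open>r\<close>.\<close>

definition h :: "nat \<Rightarrow> real" where
  "h j = (\<integral>\<omega>. (r 0 \<omega>)\<^sup>2 * r (- int j) \<omega> \<partial>M)"

lemma expect_r_sq_r:
  assumes "s \<le> t"
  shows "(\<integral>\<omega>. (r t \<omega>)\<^sup>2 * r s \<omega> \<partial>M) = h (nat (t - s))"
  using stationary_integral[of "{0, s - t}" "\<lambda>x. (x 0)\<^sup>2 * x (s - t)" t] assms
  by (simp add: h_def add.commute)

definition m2 :: real where
  "m2 = (\<integral>\<omega>. (r 0 \<omega>)\<^sup>2 \<partial>M)"

definition \<sigma> :: "int \<Rightarrow> 'a \<Rightarrow> real" where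
  "\<sigma> t \<omega> = sqrt (c\<^sup>2 + (a + X t \<omega>)\<^sup>2)"

lemma \<sigma>_sq: "(\<sigma> t \<omega>)\<^sup>2 = c\<^sup>2 + (a + X t \<omega>)\<^sup>2"
  by (simp add: \<sigma>_def)

section \<open>Tails of the series and third moments of volatility\<close>

definition Y :: "int \<Rightarrow> nat \<Rightarrow> 'a \<Rightarrow> real" where
  "Y t n \<omega> = X t \<omega> - (\<Sum>j=1..n. b j * r (t - int j) \<omega>)"

lemma X_measurable: "X t \<in> borel_measurable M"
  using X_lim by (simp add: L2_limit_def)

lemma Y_measurable[measurable]: "Y t n \<in> borel_measurable M"
  using X_measurable r_rv unfolding Y_def[abs_def] by measurable

lemma L3_partial_sum: "L3 M (\<lambda>\<omega>. \<Sum>j\<in>J. b j * r (t - int j) \<omega>)"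
  by (intro L3_sum L3_cmult L3_r)

lemma Y_sq_integrable: "integrable M (\<lambda>\<omega>. (Y t n \<omega>)\<^sup>2)"
  unfolding Y_def
proof (rule square_integrable_diff)
  show "integrable M (\<lambda>\<omega>. (\<Sum>j=1..n. b j * r (t - int j) \<omega>)\<^sup>2)"
    using L3_mult2_integrable[OF L3_partial_sum L3_partial_sum] by (simp add: power2_eq_square)
qed (use X_lim L3_partial_sum in \<open>auto simp: L2_limit_def L3_def\<close>)

lemma Y_L2_limit: "(\<lambda>n. \<integral>\<omega>. (Y t n \<omega>)\<^sup>2 \<partial>M) \<longlonglongrightarrow> 0"
  using X_lim[of t] by (simp add: L2_limit_def Y_def power2_commute)

lemma Y_split: "Y t n \<omega> = (\<Sum>i=1..N. b (n + i) * r (t - int (n + i)) \<omega>) + Y t (n + N) \<omega>"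
proof -
  have "(\<Sum>j=1..n+N. b j * r (t - int j) \<omega>) = (\<Sum>j=1..n. b j * r (t - int j) \<omega>)
      + (\<Sum>j=n+1..n+N. b j * r (t - int j) \<omega>)"
    by (rule sum.ub_add_nat) simp
  also have "(\<Sum>j=n+1..n+N. b j * r (t - int j) \<omega>) = (\<Sum>i=1..N. b (n + i) * r (t - int (n + i)) \<omega>)"
    using sum.shift_bounds_cl_nat_ivl[of "\<lambda>j. b j * r (t - int j) \<omega>" 1 n N] by (simp add: add.commute)
  finally show ?thesis by (simp add: Y_def)
qed

text \<open>The tail starts at lag \<open>n + 1\<close>, so its finite sums are measurable at time
  \<open>t - n - 1\<close>. Mean-square convergence gives a subsequence converging almost
  everywhere, whose pointwise limit is the required version.\<close>

lemma past_Y: "past (t - int n - 1) (Y t n)"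
proof -
  let ?f = "\<lambda>N \<omega>. \<Sum>i=1..N. b (n + i) * r (t - int (n + i)) \<omega>"
  have "(\<lambda>N. \<integral>\<omega>. (Y t (N + n) \<omega>)\<^sup>2 \<partial>M) \<longlonglongrightarrow> 0"
    by (rule LIMSEQ_ignore_initial_segment) (rule Y_L2_limit)
  then have "(\<lambda>N. \<integral>\<omega>. norm ((Y t (N + n) \<omega>)\<^sup>2) \<partial>M) \<longlonglongrightarrow> 0" by simp
  from tendsto_L1_AE_subseq[OF Y_sq_integrable this]
  obtain u :: "nat \<Rightarrow> nat" where u: "AE \<omega> in M. (\<lambda>N. (Y t (u N + n) \<omega>)\<^sup>2) \<longlonglongrightarrow> 0" by auto
  have "r (t - int (n + i)) \<in> borel_measurable (\<F> (t - int n - 1))" if "i \<ge> 1" for i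
    by (rule measurable_F_mono[OF _ r_adapted]) (use that in auto)
  then have "?f N \<in> borel_measurable (\<F> (t - int n - 1))" for N
    by (intro borel_measurable_sum borel_measurable_times) auto
  \<comment> \<open>\<open>lim\<close> is total and measurable even where the sequence diverges; its
    value there concerns only a null set.\<close>
  then have "(\<lambda>\<omega>. lim (\<lambda>N. ?f (u N) \<omega>)) \<in> borel_measurable (\<F> (t - int n - 1))"
    by (intro borel_measurable_lim_metric)
  moreover have "AE \<omega> in M. Y t n \<omega> = lim (\<lambda>N. ?f (u N) \<omega>)"
    using u
  proof eventually_elim
    case (elim \<omega>)
    then have "(\<lambda>N. Y t (u N + n) \<omega>) \<longlonglongrightarrow> 0"
      using tendsto_real_sqrt[OF elim] by (simp add: tendsto_rabs_zero_iff)
    then have "(\<lambda>N. Y t n \<omega> - Y t (u N + n) \<omega>) \<longlonglongrightarrow> Y t n \<omega> - 0"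
      by (intro tendsto_diff tendsto_const)
    moreover have "Y t n \<omega> - Y t (u N + n) \<omega> = ?f (u N) \<omega>" for N
      using Y_split[of t n \<omega> "u N"] by (simp add: add.commute)
    ultimately show ?case by (simp add: limI)
  qed
  ultimately show ?thesis
    unfolding past_def by (intro conjI Y_measurable bexI)
qed

lemma past_X: "past (t - 1) (X t)"
  using past_Y[of t 0] by (simp add: Y_def[abs_def])

lemma past_\<sigma>: "past (t - 1) (\<sigma> t)"
  unfolding \<sigma>_def[abs_def] by (rule past_compose[OF past_X]) measurable

lemma r_eq_\<sigma>: "AE \<omega> in M. r t \<omega> = \<zeta> t \<omega> * \<sigma> t \<omega>"
  using r_eq by (simp add: \<sigma>_def)

lemma zeta_nonzero: "\<not> (AE \<omega> in M. \<zeta> t \<omega> = 0)"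
proof
  assume *: "AE \<omega> in M. \<zeta> t \<omega> = 0"
  note [measurable] = zeta_rv
  have "(\<integral>\<omega>. (\<zeta> t \<omega>)\<^sup>2 \<partial>M) = (\<integral>\<omega>. 0 \<partial>M)"
    using * by (intro integral_cong_AE) auto
  moreover have "(\<integral>\<omega>. (\<zeta> t \<omega>)\<^sup>2 \<partial>M) = 1"
    using zeta_integral[of "\<lambda>x. x\<^sup>2" t] zeta_var by simp
  ultimately show False by simp
qed

text \<open>Independence transfers the third moment from \<open>r\<close> to \<open>\<sigma>\<close>, because \<open>\<zeta>\<close> is not degenerate.\<close>
lemma L3_\<sigma>: "L3 M (\<sigma> t)"
proof -
  obtain g where g: "g \<in> borel_measurable (\<F> (t - 1))" "AE \<omega> in M. \<sigma> t \<omega> = g \<omega>"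
    using past_\<sigma> unfolding past_def by blast
  note [measurable] = zeta_rv measurable_F_M[OF g(1)]
  have "L3 M (\<lambda>\<omega>. \<zeta> t \<omega> * g \<omega>)"
  proof (rule L3_cong_AE[OF L3_r[of t]])
    show "AE \<omega> in M. r t \<omega> = \<zeta> t \<omega> * g \<omega>"
      using r_eq_\<sigma>[of t] g(2) by eventually_elim simp
  qed measurable
  then have "L3 M g" by (rule indep_var_mult_L3_right[OF indep_innov[OF g(1)] zeta_nonzero])
  then show ?thesis
    by (rule L3_cong_AE) (use g(2) past_measurable[OF past_\<sigma>] in auto)
qed

text \<open>The third moment comes from the domination
  \<open>\<bar>a + X t \<omega>\<bar> \<le> \<sigma> t \<omega>\<close>; the series itself converges
  only in mean square.\<close>

lemma L3_X: "L3 M (X t)"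
proof (rule L3_bounded_by[OF L3_add[OF L3_\<sigma>[of t] L3_const[of "\<bar>a\<bar>"]]])
  fix \<omega>
  have "\<bar>a + X t \<omega>\<bar> \<le> \<sigma> t \<omega>"
    unfolding \<sigma>_def by (rule real_le_rsqrt) simp
  then show "\<bar>X t \<omega>\<bar> \<le> \<bar>\<sigma> t \<omega> + \<bar>a\<bar>\<bar>" by linarith
qed (rule X_measurable)

lemma L3_Y: "L3 M (Y t n)"
  unfolding Y_def[abs_def] by (intro L3_diff L3_X L3_partial_sum)

section \<open>Moments of \<open>r\<close> against functions of the past\<close>

text \<open>The martingale difference property: \<open>\<zeta> s\<close> is centred and independent
  of \<open>\<sigma> s\<close>, \<open>f\<close> and \<open>g\<close>. Two test functions are
  allowed since the expansions below involve triple products.\<close>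

lemma expect_r_past2:
  assumes "past (s - 1) f" "past (s - 1) g" "L3 M f" "L3 M g"
  shows "(\<integral>\<omega>. r s \<omega> * f \<omega> * g \<omega> \<partial>M) = 0"
proof -
  note [measurable] = zeta_rv r_rv past_measurable[OF assms(1)] past_measurable[OF assms(2)]
    past_measurable[OF past_\<sigma>]
  have "(\<integral>\<omega>. r s \<omega> * f \<omega> * g \<omega> \<partial>M) = (\<integral>\<omega>. \<zeta> s \<omega> * (\<sigma> s \<omega> * f \<omega> * g \<omega>) \<partial>M)"
    using r_eq_\<sigma>[of s] by (intro integral_cong_AE) auto
  also have "\<dots> = (\<integral>\<omega>. \<zeta> 0 \<omega> \<partial>M) * (\<integral>\<omega>. \<sigma> s \<omega> * f \<omega> * g \<omega> \<partial>M)"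
    by (rule zeta_past_integral[where \<phi> = "\<lambda>x. x"])
       (use assms zeta_int in \<open>auto intro!: past_mult past_\<sigma> L3_mult3_integrable L3_\<sigma>\<close>)
  finally show ?thesis using zeta_mean by simp
qed

lemma past_const: "past s (\<lambda>_. k)"
  by (auto simp: past_def)

lemma expect_r_past:
  assumes "past (s - 1) f" "L3 M f"
  shows "(\<integral>\<omega>. r s \<omega> * f \<omega> \<partial>M) = 0"
  using expect_r_past2[OF assms(1) past_const[of _ 1] assms(2) L3_const] by simp

lemma expect_r: "(\<integral>\<omega>. r s \<omega> \<partial>M) = 0"
  using expect_r_past[OF past_const[of _ 1] L3_const] by simp

lemma expect_r_sq_past:
  assumes "past (s - 1) f" "L3 M f"
  shows "(\<integral>\<omega>. (r s \<omega>)\<^sup>2 * f \<omega> \<partial>M) = (\<integral>\<omega>. (\<sigma> s \<omega>)\<^sup>2 * f \<omega> \<partial>M)"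
proof -
  note [measurable] = zeta_rv r_rv past_measurable[OF assms(1)] past_measurable[OF past_\<sigma>]
  have "(\<integral>\<omega>. (r s \<omega>)\<^sup>2 * f \<omega> \<partial>M) = (\<integral>\<omega>. (\<zeta> s \<omega>)\<^sup>2 * (\<sigma> s \<omega> * \<sigma> s \<omega> * f \<omega>) \<partial>M)"
    using r_eq_\<sigma>[of s] by (intro integral_cong_AE) (auto simp: power2_eq_square)
  also have "\<dots> = (\<integral>\<omega>. (\<zeta> 0 \<omega>)\<^sup>2 \<partial>M) * (\<integral>\<omega>. \<sigma> s \<omega> * \<sigma> s \<omega> * f \<omega> \<partial>M)"
    by (rule zeta_past_integral[where \<phi> = "\<lambda>x. x\<^sup>2"])
       (use assms zeta_sq_int in \<open>auto intro!: past_mult past_\<sigma> L3_mult3_integrable L3_\<sigma>\<close>)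
  finally show ?thesis using zeta_var by (simp add: power2_eq_square)
qed

text \<open>This is where the vanishing third moment of the innovations enters; it removes the term
  in \<open>(b j)\<^sup>2\<close> from the recursion for \<open>h\<close>.\<close>

lemma expect_r_cube: "(\<integral>\<omega>. r s \<omega> * r s \<omega> * r s \<omega> \<partial>M) = 0"
proof -
  note [measurable] = zeta_rv r_rv past_measurable[OF past_\<sigma>]
  have "(\<integral>\<omega>. r s \<omega> * r s \<omega> * r s \<omega> \<partial>M) = (\<integral>\<omega>. (\<zeta> s \<omega>) ^ 3 * (\<sigma> s \<omega> * \<sigma> s \<omega> * \<sigma> s \<omega>) \<partial>M)"
    using r_eq_\<sigma>[of s] by (intro integral_cong_AE) (auto simp: power3_eq_cube)
  also have "\<dots> = (\<integral>\<omega>. (\<zeta> 0 \<omega>) ^ 3 \<partial>M) * (\<integral>\<omega>. \<sigma> s \<omega> * \<sigma> s \<omega> * \<sigma> s \<omega> \<partial>M)"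
  proof (rule zeta_past_integral[where \<phi> = "\<lambda>x. x ^ 3"])
    show "integrable M (\<lambda>\<omega>. \<zeta> 0 \<omega> ^ 3)"
      using zeta_abs3 by (subst integrable_abs_iff[symmetric]) (auto simp: power_abs)
  qed (auto intro!: past_mult past_\<sigma> L3_mult3_integrable L3_\<sigma>)
  finally show ?thesis using zeta_mu3 by simp
qed

text \<open>The partial sums are centred, so every tail has the mean of \<open>X t\<close>; the
  squared mean is at most the second moment of the tail, which tends to 0.\<close>

lemma expect_X: "(\<integral>\<omega>. X t \<omega> \<partial>M) = 0"
proof -
  have EY: "(\<integral>\<omega>. Y t n \<omega> \<partial>M) = (\<integral>\<omega>. X t \<omega> \<partial>M)" for n
    unfolding Y_def using L3_X[THEN L3_integrable, of t] L3_r[THEN L3_integrable]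
    by (simp add: expect_r)
  have "(\<integral>\<omega>. X t \<omega> \<partial>M)\<^sup>2 \<le> (\<integral>\<omega>. (Y t n \<omega>)\<^sup>2 \<partial>M)" for n
    using variance_eq[OF L3_integrable[OF L3_Y] Y_sq_integrable, of t n] variance_positive[of "Y t n"]
    by (simp add: EY)
  then have "(\<integral>\<omega>. X t \<omega> \<partial>M)\<^sup>2 \<le> 0"
    by (intro tendsto_lowerbound[OF Y_L2_limit[of t]]) auto
  then show ?thesis by simp
qed

lemma m2_pos:
  assumes "a \<noteq> 0"
  shows "m2 > 0"
proof -
  have X2: "integrable M (\<lambda>\<omega>. (X 0 \<omega>)\<^sup>2)" using X_lim by (simp add: L2_limit_def)
  have "m2 = (\<integral>\<omega>. (\<sigma> 0 \<omega>)\<^sup>2 \<partial>M)"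
    using expect_r_sq_past[OF past_const[of _ 1] L3_const, of 0] by (simp add: m2_def)
  also have "\<dots> = (\<integral>\<omega>. c\<^sup>2 + a\<^sup>2 + 2 * a * X 0 \<omega> + (X 0 \<omega>)\<^sup>2 \<partial>M)"
    by (simp add: \<sigma>_sq power2_sum algebra_simps)
  also have "\<dots> = c\<^sup>2 + a\<^sup>2 + (\<integral>\<omega>. (X 0 \<omega>)\<^sup>2 \<partial>M)"
    using X2 L3_integrable[OF L3_X[of 0]] by (simp add: expect_X prob_space)
  moreover have "0 \<le> (\<integral>\<omega>. (X 0 \<omega>)\<^sup>2 \<partial>M)" by simp
  moreover have "0 < a\<^sup>2" using assms by simp
  ultimately show ?thesis
    using zero_le_power2[of c] by linarith
qed

text \<open>By convexity \<open>\<bar>U + Y\<bar>\<^sup>3 \<ge> \<bar>Y\<bar>\<^sup>3 + 3 U Y \<bar>Y\<bar>\<close>, where the last term is centred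
  since the partial sum \<open>U\<close> consists of martingale differences with respect to the past of \<open>Y\<close>.\<close>
lemma expect_Y_cube_le: "(\<integral>\<omega>. \<bar>Y t n \<omega>\<bar> ^ 3 \<partial>M) \<le> (\<integral>\<omega>. \<bar>X t \<omega>\<bar> ^ 3 \<partial>M)"
proof -
  let ?U = "\<lambda>\<omega>. \<Sum>j=1..n. b j * r (t - int j) \<omega>"
  have absY: "L3 M (\<lambda>\<omega>. \<bar>Y t n \<omega>\<bar>)"
    by (rule L3_bounded_by[OF L3_Y[of t n]]) auto
  have integrable_rYY: "integrable M (\<lambda>\<omega>. r s \<omega> * Y t n \<omega> * \<bar>Y t n \<omega>\<bar>)" for s
    by (intro L3_mult3_integrable L3_r L3_Y absY)
  have U0: "(\<integral>\<omega>. ?U \<omega> * Y t n \<omega> * \<bar>Y t n \<omega>\<bar> \<partial>M) = 0"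
  proof -
    have "(\<integral>\<omega>. ?U \<omega> * Y t n \<omega> * \<bar>Y t n \<omega>\<bar> \<partial>M)
        = (\<integral>\<omega>. (\<Sum>j=1..n. b j * (r (t - int j) \<omega> * Y t n \<omega> * \<bar>Y t n \<omega>\<bar>)) \<partial>M)"
      by (simp add: sum_distrib_right mult.assoc)
    also have "\<dots> = (\<Sum>j=1..n. b j * (\<integral>\<omega>. r (t - int j) \<omega> * Y t n \<omega> * \<bar>Y t n \<omega>\<bar> \<partial>M))"
      using integrable_rYY by simp
    also have "\<dots> = 0"
    proof (rule sum.neutral, safe)
      fix j assume j: "j \<in> {1..n}"
      have pY: "past (t - int j - 1) (Y t n)"
        by (rule past_mono[OF past_Y]) (use j in auto)
      have "past (t - int j - 1) (\<lambda>\<omega>. \<bar>Y t n \<omega>\<bar>)"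
        by (rule past_compose[OF pY]) measurable
      from expect_r_past2[OF pY this L3_Y absY]
      show "b j * (\<integral>\<omega>. r (t - int j) \<omega> * Y t n \<omega> * \<bar>Y t n \<omega>\<bar> \<partial>M) = 0" by simp
    qed
    finally show ?thesis .
  qed
  have UYY: "integrable M (\<lambda>\<omega>. ?U \<omega> * Y t n \<omega> * \<bar>Y t n \<omega>\<bar>)"
    by (intro L3_mult3_integrable L3_partial_sum L3_Y absY)
  have Y3: "integrable M (\<lambda>\<omega>. \<bar>Y t n \<omega>\<bar> ^ 3)" using L3_Y by (simp add: L3_def)
  have "(\<integral>\<omega>. \<bar>Y t n \<omega>\<bar> ^ 3 \<partial>M) = (\<integral>\<omega>. \<bar>Y t n \<omega>\<bar> ^ 3 + 3 * (?U \<omega> * Y t n \<omega> * \<bar>Y t n \<omega>\<bar>) \<partial>M)"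
    using UYY Y3 U0 by simp
  also have "\<dots> \<le> (\<integral>\<omega>. \<bar>X t \<omega>\<bar> ^ 3 \<partial>M)"
  proof (rule integral_mono)
    show "integrable M (\<lambda>\<omega>. \<bar>Y t n \<omega>\<bar> ^ 3 + 3 * (?U \<omega> * Y t n \<omega> * \<bar>Y t n \<omega>\<bar>))"
      using UYY Y3 by (intro Bochner_Integration.integrable_add integrable_mult_right)
    show "integrable M (\<lambda>\<omega>. \<bar>X t \<omega>\<bar> ^ 3)" using L3_X by (simp add: L3_def)
    show "\<bar>Y t n \<omega>\<bar> ^ 3 + 3 * (?U \<omega> * Y t n \<omega> * \<bar>Y t n \<omega>\<bar>) \<le> \<bar>X t \<omega>\<bar> ^ 3" for \<omega>
      using abs_cube_add_ge[of "Y t n \<omega>" "?U \<omega>"] by (simp add: Y_def)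
  qed
  finally show ?thesis .
qed

section \<open>The remainder of the leverage recursion\<close>

definition S :: "nat \<Rightarrow> real" where
  "S j = (\<integral>\<omega>. (r (- int j) \<omega>)\<^sup>2 * Y 0 j \<omega> \<partial>M)"

text \<open>What matters is uniformity in \<open>j\<close>: this is the a priori bound that starts
  the bootstrap in \<open>leverage_remainder_bound\<close>.\<close>

lemma S_bounded: "\<bar>S j\<bar> \<le> 2 * (\<integral>\<omega>. \<bar>r 0 \<omega>\<bar> ^ 3 \<partial>M) + (\<integral>\<omega>. \<bar>X 0 \<omega>\<bar> ^ 3 \<partial>M)"
proof -
  let ?R = "r (- int j)"
  have R3: "integrable M (\<lambda>\<omega>. \<bar>?R \<omega>\<bar> ^ 3)" using L3_r by (simp add: L3_def)
  have Y3: "integrable M (\<lambda>\<omega>. \<bar>Y 0 j \<omega>\<bar> ^ 3)" using L3_Y by (simp add: L3_def)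
  have "\<bar>S j\<bar> \<le> (\<integral>\<omega>. \<bar>?R \<omega> * ?R \<omega> * Y 0 j \<omega>\<bar> \<partial>M)"
    unfolding S_def power2_eq_square using integral_norm_bound[of M "\<lambda>\<omega>. ?R \<omega> * ?R \<omega> * Y 0 j \<omega>"] by simp
  also have "\<dots> \<le> (\<integral>\<omega>. \<bar>?R \<omega>\<bar> ^ 3 + \<bar>?R \<omega>\<bar> ^ 3 + \<bar>Y 0 j \<omega>\<bar> ^ 3 \<partial>M)"
    using R3 Y3 by (intro integral_mono abs_mult3_le integrable_abs L3_mult3_integrable L3_r L3_Y
        Bochner_Integration.integrable_add)
  also have "\<dots> = 2 * (\<integral>\<omega>. \<bar>?R \<omega>\<bar> ^ 3 \<partial>M) + (\<integral>\<omega>. \<bar>Y 0 j \<omega>\<bar> ^ 3 \<partial>M)"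
    using R3 Y3 by simp
  also have "(\<integral>\<omega>. \<bar>?R \<omega>\<bar> ^ 3 \<partial>M) = (\<integral>\<omega>. \<bar>r 0 \<omega>\<bar> ^ 3 \<partial>M)"
    using stationary_integral[of "{0}" "\<lambda>x. \<bar>x 0\<bar> ^ 3" "- int j"] by simp
  finally show ?thesis using expect_Y_cube_le[of 0 j] by simp
qed

text \<open>Splitting \<open>N\<close> further terms off the tail turns \<open>S j\<close> into the
  partial sum plus a weighted deeper tail; stationarity identifies the coefficients as
  \<open>h i\<close>, and the deeper tail vanishes by \<open>L3_weighted_limit_0\<close>.\<close>

lemma S_sums: "(\<lambda>N. \<Sum>i=1..N. b (j + i) * h i) \<longlonglongrightarrow> S j"
proof -
  let ?R = "r (- int j)"
  have RRf: "integrable M (\<lambda>\<omega>. (?R \<omega>)\<^sup>2 * f \<omega>)" if "L3 M f" for f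
    using L3_mult3_integrable[OF L3_r L3_r that] by (simp add: power2_eq_square)
  have partial: "(\<Sum>i=1..N. b (j + i) * h i) = S j - (\<integral>\<omega>. (?R \<omega>)\<^sup>2 * Y 0 (N + j) \<omega> \<partial>M)" for N
  proof -
    have "S j = (\<integral>\<omega>. (\<Sum>i=1..N. b (j + i) * ((?R \<omega>)\<^sup>2 * r (- int (j + i)) \<omega>)) + (?R \<omega>)\<^sup>2 * Y 0 (N + j) \<omega> \<partial>M)"
      unfolding S_def Y_split[of 0 j _ N]
      by (simp add: distrib_left sum_distrib_left mult_ac add.commute[of N j])
    also have "\<dots> = (\<Sum>i=1..N. b (j + i) * (\<integral>\<omega>. (?R \<omega>)\<^sup>2 * r (- int (j + i)) \<omega> \<partial>M))
        + (\<integral>\<omega>. (?R \<omega>)\<^sup>2 * Y 0 (N + j) \<omega> \<partial>M)"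
      using RRf[OF L3_r] RRf[OF L3_Y] by simp
    also have "(\<Sum>i=1..N. b (j + i) * (\<integral>\<omega>. (?R \<omega>)\<^sup>2 * r (- int (j + i)) \<omega> \<partial>M)) = (\<Sum>i=1..N. b (j + i) * h i)"
      by (intro sum.cong refl) (subst expect_r_sq_r; simp)
    finally show ?thesis by simp
  qed
  have "(\<lambda>n. \<integral>\<omega>. (?R \<omega>)\<^sup>2 * Y 0 n \<omega> \<partial>M) \<longlonglongrightarrow> 0"
    by (rule L3_weighted_limit_0[OF L3_r L3_Y expect_Y_cube_le Y_L2_limit])
  then have "(\<lambda>N. S j - (\<integral>\<omega>. (?R \<omega>)\<^sup>2 * Y 0 (N + j) \<omega> \<partial>M)) \<longlonglongrightarrow> S j - 0"
    by (intro tendsto_diff tendsto_const LIMSEQ_ignore_initial_segment)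
  then show ?thesis unfolding partial by simp
qed

section \<open>The recursion for the leverage coefficients\<close>

text \<open>Off the diagonal, the latest of the three factors is a martingale difference relative to
  the other two.\<close>

lemma expect_rrr:
  assumes "u < j" "v < j"
  shows "(\<integral>\<omega>. r (- int u) \<omega> * r (- int v) \<omega> * r (- int j) \<omega> \<partial>M) = (if u = v then h (j - u) else 0)"
proof (cases u v rule: linorder_cases)
  case less
  then show ?thesis
    using expect_r_past2[of "- int u" "r (- int v)" "r (- int j)"] assms by (simp add: past_r L3_r)
next
  case equal
  have "nat (int j - int v) = j - v" by simp
  with equal show ?thesis
    using expect_r_sq_r[of "- int j" "- int u"] assms by (simp add: power2_eq_square)
next
  case greater
  have "(\<integral>\<omega>. r (- int v) \<omega> * r (- int u) \<omega> * r (- int j) \<omega> \<partial>M) = 0"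
    using expect_r_past2[of "- int v" "r (- int u)" "r (- int j)"] assms greater by (simp add: past_r L3_r)
  then show ?thesis using greater by (simp add: mult.commute)
qed

text \<open>Of the ten terms of \<open>(\<sigma> 0)\<^sup>2\<close> times
  \<open>r (- int j)\<close>, only three have nonzero contributions: those in
  \<open>?R * ?R\<close>, \<open>P * P * ?R\<close> and \<open>?R * ?R * ?Y\<close>. The others
  contain an unmatched martingale difference or the third power of \<open>?R\<close>.\<close>

lemma h_rec:
  assumes j: "1 \<le> j"
  shows "h j = 2 * (a * m2) * b j + (\<Sum>u\<in>{1..<j}. (b u)\<^sup>2 * h (j - u)) + 2 * b j * S j"
proof -
  let ?R = "r (- int j)" and ?Y = "Y 0 j"
  define P where "P \<omega> = (\<Sum>u\<in>{1..<j}. b u * r (- int u) \<omega>)" for \<omega>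
  have LP: "L3 M P" unfolding P_def[abs_def] by (intro L3_sum L3_cmult L3_r)
  have pR: "past (- int j) ?R" by (rule past_r) simp
  have pY: "past (- int j - 1) ?Y" using past_Y[of 0 j] by simp
  have X_split: "X 0 \<omega> = P \<omega> + b j * ?R \<omega> + ?Y \<omega>" for \<omega>
  proof -
    have "{1..j} = insert j {1..<j}" using j by auto
    then show ?thesis by (simp add: Y_def P_def)
  qed
  \<comment> \<open>Each summand of \<open>P\<close> lies at a time \<open>-u\<close> with
    \<open>u < j\<close>, hence strictly after \<open>-j\<close>, and is centred given the past at
    \<open>-j\<close>.\<close>
  have P0: "(\<integral>\<omega>. P \<omega> * f \<omega> * g \<omega> \<partial>M) = 0"
    if fg: "past (- int j) f" "past (- int j) g" "L3 M f" "L3 M g" for f g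
  proof -
    have "(\<integral>\<omega>. P \<omega> * f \<omega> * g \<omega> \<partial>M) = (\<integral>\<omega>. (\<Sum>u\<in>{1..<j}. b u * (r (- int u) \<omega> * f \<omega> * g \<omega>)) \<partial>M)"
      by (simp add: P_def sum_distrib_right mult.assoc)
    also have "\<dots> = (\<Sum>u\<in>{1..<j}. b u * (\<integral>\<omega>. r (- int u) \<omega> * f \<omega> * g \<omega> \<partial>M))"
      using L3_mult3_integrable[OF L3_r fg(3,4)] by simp
    also have "\<dots> = 0"
    proof (rule sum.neutral, safe)
      fix u assume "u \<in> {1..<j}"
      then have "past (- int u - 1) f" "past (- int u - 1) g"
        using fg by (auto intro: past_mono)
      from expect_r_past2[OF this fg(3,4)]
      show "b u * (\<integral>\<omega>. r (- int u) \<omega> * f \<omega> * g \<omega> \<partial>M) = 0" by simp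
    qed
    finally show ?thesis .
  qed
  have PPR: "(\<integral>\<omega>. P \<omega> * P \<omega> * ?R \<omega> \<partial>M) = (\<Sum>u\<in>{1..<j}. (b u)\<^sup>2 * h (j - u))"
  proof -
    have "(\<integral>\<omega>. P \<omega> * P \<omega> * ?R \<omega> \<partial>M) =
        (\<integral>\<omega>. (\<Sum>u\<in>{1..<j}. \<Sum>v\<in>{1..<j}. b u * b v * (r (- int u) \<omega> * r (- int v) \<omega> * ?R \<omega>)) \<partial>M)"
      unfolding P_def sum_product sum_distrib_right
      by (intro Bochner_Integration.integral_cong sum.cong refl)
        (simp add: sum_distrib_left mult_ac)
    also have "\<dots> = (\<Sum>u\<in>{1..<j}. \<Sum>v\<in>{1..<j}. b u * b v * (\<integral>\<omega>. r (- int u) \<omega> * r (- int v) \<omega> * ?R \<omega> \<partial>M))"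
      using L3_mult3_integrable[OF L3_r L3_r L3_r] by simp
    also have "\<dots> = (\<Sum>u\<in>{1..<j}. \<Sum>v\<in>{1..<j}. if u = v then (b u)\<^sup>2 * h (j - u) else 0)"
      by (intro sum.cong refl) (auto simp: expect_rrr power2_eq_square)
    also have "\<dots> = (\<Sum>u\<in>{1..<j}. (b u)\<^sup>2 * h (j - u))"
      by (intro sum.cong refl) simp
    finally show ?thesis .
  qed
  have pY': "past (- int j) ?Y" by (rule past_mono[OF pY]) simp
  have PR: "(\<integral>\<omega>. P \<omega> * ?R \<omega> \<partial>M) = 0"
    using P0[OF pR past_const[of _ 1] L3_r L3_const] by simp
  have RY: "(\<integral>\<omega>. ?R \<omega> * ?Y \<omega> \<partial>M) = 0" by (rule expect_r_past[OF pY L3_Y])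
  have RR: "(\<integral>\<omega>. ?R \<omega> * ?R \<omega> \<partial>M) = m2"
    using expect_r_sq[of "- int j"] by (simp add: m2_def power2_eq_square)
  have RRY: "(\<integral>\<omega>. ?R \<omega> * ?R \<omega> * ?Y \<omega> \<partial>M) = S j" by (simp add: S_def power2_eq_square)
  have int3: "integrable M (\<lambda>\<omega>. P \<omega> * P \<omega> * ?R \<omega>)" "integrable M (\<lambda>\<omega>. P \<omega> * ?R \<omega> * ?R \<omega>)"
    "integrable M (\<lambda>\<omega>. P \<omega> * ?R \<omega> * ?Y \<omega>)" "integrable M (\<lambda>\<omega>. ?R \<omega> * ?R \<omega> * ?R \<omega>)"
    "integrable M (\<lambda>\<omega>. ?R \<omega> * ?R \<omega> * ?Y \<omega>)" "integrable M (\<lambda>\<omega>. ?R \<omega> * ?Y \<omega> * ?Y \<omega>)"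
    by (intro L3_mult3_integrable LP L3_r L3_Y)+
  have int2: "integrable M (\<lambda>\<omega>. P \<omega> * ?R \<omega>)" "integrable M (\<lambda>\<omega>. ?R \<omega> * ?R \<omega>)"
    "integrable M (\<lambda>\<omega>. ?R \<omega> * ?Y \<omega>)"
    by (intro L3_mult2_integrable LP L3_r L3_Y)+
  have "h j = (\<integral>\<omega>. (\<sigma> 0 \<omega>)\<^sup>2 * ?R \<omega> \<partial>M)"
    unfolding h_def using j by (intro expect_r_sq_past past_r L3_r) auto
  also have "\<dots> = (\<integral>\<omega>. (c\<^sup>2 + a\<^sup>2) * ?R \<omega> + 2 * a * (P \<omega> * ?R \<omega>) + 2 * a * b j * (?R \<omega> * ?R \<omega>)
      + 2 * a * (?R \<omega> * ?Y \<omega>) + P \<omega> * P \<omega> * ?R \<omega> + 2 * b j * (P \<omega> * ?R \<omega> * ?R \<omega>)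
      + 2 * (P \<omega> * ?R \<omega> * ?Y \<omega>) + (b j)\<^sup>2 * (?R \<omega> * ?R \<omega> * ?R \<omega>)
      + 2 * b j * (?R \<omega> * ?R \<omega> * ?Y \<omega>) + ?R \<omega> * ?Y \<omega> * ?Y \<omega> \<partial>M)"
    unfolding \<sigma>_sq X_split by (intro Bochner_Integration.integral_cong refl)
      (simp add: power2_eq_square algebra_simps)
  also have "\<dots> = 2 * a * b j * m2 + (\<Sum>u\<in>{1..<j}. (b u)\<^sup>2 * h (j - u)) + 2 * b j * S j"
    using int3 int2 L3_integrable[OF L3_r]
    by (simp add: PPR PR RY RR RRY expect_r expect_r_cube P0[OF pR pR L3_r L3_r]
        P0[OF pR pY' L3_r L3_Y] expect_r_past2[OF pY pY L3_Y L3_Y])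
  finally show ?thesis by (simp add: mult_ac)
qed

text \<open>As \<open>r\<close> is centred, only the mixed moment survives; the squared volatility
  may then be replaced by the squared return, because the other factor lies in the strict
  past.\<close>

lemma cov_eq_h:
  assumes j: "1 \<le> j"
  shows "cov M (\<lambda>\<omega>. c\<^sup>2 + (a + X t \<omega>)\<^sup>2) (r (t - int j)) = h j"
proof -
  let ?R = "r (t - int j)"
  let ?m = "\<integral>\<omega>. (\<sigma> t \<omega>)\<^sup>2 \<partial>M"
  have "integrable M (\<lambda>\<omega>. (\<sigma> t \<omega>)\<^sup>2 * ?R \<omega>)"
    using L3_mult3_integrable[OF L3_\<sigma> L3_\<sigma> L3_r] by (simp add: power2_eq_square)
  then have "(\<integral>\<omega>. ((\<sigma> t \<omega>)\<^sup>2 - ?m) * ?R \<omega> \<partial>M) = (\<integral>\<omega>. (\<sigma> t \<omega>)\<^sup>2 * ?R \<omega> \<partial>M)"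
    using L3_integrable[OF L3_r] by (simp add: left_diff_distrib expect_r)
  also have "\<dots> = (\<integral>\<omega>. (r t \<omega>)\<^sup>2 * ?R \<omega> \<partial>M)"
    using j by (intro expect_r_sq_past[symmetric] past_r L3_r) auto
  also have "\<dots> = h j" by (subst expect_r_sq_r) auto
  finally show ?thesis by (simp add: cov_def expect_r \<sigma>_sq)
qed

section \<open>The signs of the leverage coefficients\<close>

lemma
  assumes B2: "(\<lambda>j. (b (Suc j))\<^sup>2) sums B2" "B2 < 1/5"
    and j: "1 \<le> j" "enat j \<le> k"
  shows leverage_sign_pos:
      "a * b 1 > 0 \<Longrightarrow> (\<And>i. 2 \<le> i \<Longrightarrow> enat i \<le> k \<Longrightarrow> a * b i \<ge> 0) \<Longrightarrow> h j > 0"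
    and leverage_sign_neg:
      "a * b 1 < 0 \<Longrightarrow> (\<And>i. 2 \<le> i \<Longrightarrow> enat i \<le> k \<Longrightarrow> a * b i \<le> 0) \<Longrightarrow> h j < 0"
proof -
  have b2: "(\<Sum>j=1..N. (b j)\<^sup>2) \<le> B2" for N
  proof -
    have "(\<Sum>j=1..N. (b j)\<^sup>2) = (\<Sum>j<N. (b (Suc j))\<^sup>2)"
      by (simp add: sum.atLeast1_atMost_eq)
    also have "\<dots> \<le> B2"
      using B2(1) by (auto simp: sums_iff intro: sum_le_suminf)
    finally show ?thesis .
  qed
  \<comment> \<open>The role of \<open>A\<close> is played by \<open>a * m2\<close>; since
    \<open>m2 > 0\<close>, it has the sign of \<open>a\<close>.\<close>
  have S: "\<bar>S i\<bar> < \<bar>a * m2\<bar>" if "a \<noteq> 0" "1 \<le> i" for i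
    by (rule leverage_remainder_bound[OF b2 B2(2) h_rec S_bounded S_sums _ that(2)])
       (use m2_pos that in auto)
  show "h j > 0" if "a * b 1 > 0" "\<And>i. 2 \<le> i \<Longrightarrow> enat i \<le> k \<Longrightarrow> a * b i \<ge> 0"
  proof (rule leverage_pos[OF h_rec S _ _ j])
    have a: "a \<noteq> 0" using that(1) by auto
    from m2_pos[OF a] have "0 < m2 * (a * b 1)" using that(1) by (rule mult_pos_pos)
    then show "0 < a * m2 * b 1" by (simp only: mult_ac)
    fix i assume i: "2 \<le> i" "enat i \<le> k"
    have "0 \<le> m2 * (a * b i)" by (rule mult_nonneg_nonneg[OF less_imp_le[OF m2_pos[OF a]] that(2)[OF i]])
    then show "0 \<le> a * m2 * b i" by (simp only: mult_ac)
  qed (use that in auto)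
  show "h j < 0" if "a * b 1 < 0" "\<And>i. 2 \<le> i \<Longrightarrow> enat i \<le> k \<Longrightarrow> a * b i \<le> 0"
  proof -
    have a: "a \<noteq> 0" using that(1) by auto
    have "- h j > 0"
    \<comment> \<open>The recursion is invariant under a simultaneous sign change of
      \<open>h\<close>, \<open>A\<close> and \<open>S\<close>, which reduces the negative case to
      the positive one with the same \<open>b\<close>.\<close>
    proof (rule leverage_pos[where h = "\<lambda>j. - h j" and A = "- (a * m2)" and S = "\<lambda>j. - S j", OF _ _ _ _ j])
      show "- h i = 2 * (- (a * m2)) * b i + (\<Sum>u\<in>{1..<i}. (b u)\<^sup>2 * (- h (i - u))) + 2 * b i * (- S i)"
        if "1 \<le> i" for i
        using h_rec[OF that] by (simp add: sum_negf)
      have "m2 * (a * b 1) < 0" using m2_pos[OF a] that(1) by (rule mult_pos_neg)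
      then show "0 < - (a * m2) * b 1" by (simp add: mult_ac)
      fix i assume i: "2 \<le> i" "enat i \<le> k"
      have "m2 * (a * b i) \<le> 0" by (rule mult_nonneg_nonpos[OF less_imp_le[OF m2_pos[OF a]] that(2)[OF i]])
      then show "0 \<le> - (a * m2) * b i" by (simp add: mult_ac)
    qed (use S[OF a] in simp)
    then show ?thesis by simp
  qed
qed

end

theorem theorem11:
  fixes M :: "'a measure"
    and \<zeta> r X :: "int \<Rightarrow> 'a \<Rightarrow> real"
    and a c B2 :: real
    and b :: "nat \<Rightarrow> real"
    and k :: enat
  assumes P: "prob_space M"
    (* zeta i.i.d. with the moment conditions *)
    and zeta_rv: "\<And>t. \<zeta> t \<in> borel_measurable M"
    and zeta_indep: "prob_space.indep_vars M (\<lambda>_. borel) \<zeta> UNIV"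
    and zeta_id: "\<And>t. distr M borel (\<zeta> t) = distr M borel (\<zeta> 0)"
    and zeta_int: "integrable M (\<zeta> 0)"
    and zeta_mean: "(\<integral>\<omega>. \<zeta> 0 \<omega> \<partial>M) = 0"
    and zeta_sq_int: "integrable M (\<lambda>\<omega>. (\<zeta> 0 \<omega>)\<^sup>2)"
    and zeta_var: "(\<integral>\<omega>. (\<zeta> 0 \<omega>)\<^sup>2 \<partial>M) = 1"
    and zeta_abs3: "integrable M (\<lambda>\<omega>. \<bar>\<zeta> 0 \<omega>\<bar> ^ 3)"
    and zeta_mu3: "(\<integral>\<omega>. (\<zeta> 0 \<omega>) ^ 3 \<partial>M) = 0"
    (* parameters *)
    and c_nonneg: "c \<ge> 0"
    and B2_def: "(\<lambda>j. (b (Suc j))\<^sup>2) sums B2"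
    and B2_small: "B2 < 1/5"
    (* r is an adapted L^2 process *)
    and r_adapted: "\<And>t. r t \<in> borel_measurable (nat_filtration M \<zeta> t)"
    and r_rv: "\<And>t. r t \<in> borel_measurable M"
    and r_L2: "\<And>t. integrable M (\<lambda>\<omega>. (r t \<omega>)\<^sup>2)"
    (* X t is the L^2-limit of the series sum_{s<t} b_{t-s} r_s *)
    and X_lim: "\<And>t. L2_limit M (\<lambda>n \<omega>. \<Sum>j=1..n. b j * r (t - int j) \<omega>) (X t)"
    (* the equation r_t = zeta_t * sigma_t *)
    and r_eq: "\<And>t. AE \<omega> in M. r t \<omega> = \<zeta> t \<omega> * sqrt (c\<^sup>2 + (a + X t \<omega>)\<^sup>2)"
    (* stationarity and third moment *)
    and r_stat: "strictly_stationary M r"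
    and r_abs3: "integrable M (\<lambda>\<omega>. \<bar>r 0 \<omega>\<bar> ^ 3)"
    and k_ge: "k \<ge> 1"
  shows
    "(a * b 1 < 0 \<and> (\<forall>j::nat. 2 \<le> j \<and> enat j \<le> k \<longrightarrow> a * b j \<le> 0) \<longrightarrow>
        (\<forall>j::nat. \<forall>t. 1 \<le> j \<and> enat j \<le> k \<longrightarrow>
           cov M (\<lambda>\<omega>. c\<^sup>2 + (a + X t \<omega>)\<^sup>2) (r (t - int j)) < 0))
     \<and>
     (a * b 1 > 0 \<and> (\<forall>j::nat. 2 \<le> j \<and> enat j \<le> k \<longrightarrow> a * b j \<ge> 0) \<longrightarrow>
        (\<forall>j::nat. \<forall>t. 1 \<le> j \<and> enat j \<le> k \<longrightarrow>
           cov M (\<lambda>\<omega>. c\<^sup>2 + (a + X t \<omega>)\<^sup>2) (r (t - int j)) > 0))"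
proof -
  interpret prob_space M by (rule P)
  interpret quadratic_arch M \<zeta> r X a c b
    by unfold_locales (fact assms)+
  show ?thesis
    using leverage_sign_pos[OF B2_def B2_small] leverage_sign_neg[OF B2_def B2_small]
    by (auto simp: cov_eq_h)
qed

end
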